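(* Let $(M,\mathcal T)$ be a triangulated three-manifold with $N$ ideal tetrahedra, and let $(z_j)\in\mathbb R^N$ be a solution to Thurston's equations determining a transversely hyperbolic foliation $\mathcal F$ on $(M,\mathcal T)$. Suppose the real deformation variety $\mathscr D_{\mathbb R}$ is smooth at $(z_j)$, and suppose that $(v_j)\in\mathbb R^N$ is a tangent vector to $\mathscr D_{\mathbb R}$ at $(z_j)$ such that $v_j>0$ for all $j$. Then there are hyperbolic structures $\mathscr H_t$ and $\mathrm{AdS}$ structures $\mathscr A_t$ on $(M,\mathcal T)$, defined for $t>0$, such that $\mathscr H_t$ and $\mathscr A_t$ collapse to $\mathcal F$ as $t\to0$.
   Context: $M$ is an oriented three-manifold with a union of tori as boundary and $\mathcal T=\{\mathcal T_1,\dots,\mathcal T_N\}$ is a topological ideal triangulation of $M$: $M$ is the union of the tetrahedra $\mathcal T_j$, with vertices removed, glued together along faces. Thurston's equations. Let $\mathcal B$ be $\mathbb R$, $\mathbb C$, or the pseudo-complex numbers $\mathbb R+\mathbb R\tau$, $\tau^2=+1$, with $|a+b\tau|^2=a^2-b^2$. A shape parameter is $z\in\mathcal B$ with $|z|^2>0$ and $|1-z|^2>0$ (for $\mathbb R,\mathbb C$: $z\neq0,1$). Fix an orientation-compatible ordering $v_1,v_2,v_3,v_4$ of the vertices of each $\mathcal T_j$; a shape parameter $z_j$ of $\mathcal T_j$ is assigned to edges $v_1v_2,v_3v_4$, then $\frac1{1-z_j}$ is assigned to $v_1v_3,v_2v_4$ and $\frac{z_j-1}{z_j}$ to $v_1v_4,v_2v_3$.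 Thurston's equations over $\mathcal B$ require, for each interior edge $e$ of $\mathcal T$, that the product of the shape parameters of all tetrahedron edges identified to $e$ is $1$, and that $e$ has total dihedral angle $2\pi$, meaning: over $\mathbb C$ (for positive imaginary parts) the arguments in $(0,\pi)$ of these parameters sum to $2\pi$; over $\mathbb R$, exactly two of these parameters are negative; over $\mathbb R+\mathbb R\tau$, exactly two of them have negative real part. The real deformation variety $\mathscr D_{\mathbb R}\subset(\mathbb R\setminus\{0,1\})^N$ is the set of solutions over $\mathbb R$; it is smooth at a point if near that point it is a smooth embedded submanifold of $\mathbb R^N$. Structures. A solution over $\mathbb R$ determines a transversely hyperbolic foliation on $(M,\mathcal T)$: lifted tetrahedra in $\widetilde M$ are mapped by submersions onto ideal quadrilaterals in $\mathbb H^2$ with the given real cross ratios, fitting together to an equivariant local submersion $\widetilde M\to\mathbb H^2$. A solution over $\mathbb C$ (resp. $\mathbb R+\mathbb R\tau$) with all $z_j$ of positive imaginary part (coefficient of $i$, resp. $\tau$) determines a hyperbolic (resp. anti de Sitter, $\mathrm{AdS}$) structure on $M$ by gluing positively oriented ideal tetrahedra of $\mathbb H^3$ (resp. $\mathrm{AdS}^3$) with these shape parameters; these are the hyperbolic (resp. $\mathrm{AdS}$) structures on $(M,\mathcal T)$. A path $\mathscr H_t$ or $\mathscr A_t$ ($t>0$) collapses to $\mathcal F$ as $t\to0$ if it is given by a continuous path of such solutions whose shape parameters converge, as $t\to0$, to the real shape parameters $(z_j)$ determining $\mathcal F$. *)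

theory Defs
  imports "HOL-Analysis.Analysis" "HOL-Combinatorics.Permutations"
begin

section \<open>The pseudo-complex numbers\<close>

text \<open>The element \<open>PComplex a b\<close> is $a + b\tau$ with $\tau^2 = +1$.\<close>

datatype pcomplex = PComplex (PRe: real) (PIm: real)

lemma pcomplex_eq_iff: "x = y \<longleftrightarrow> PRe x = PRe y \<and> PIm x = PIm y"
  by (auto intro: pcomplex.expand)

definition pc_sqnorm :: "pcomplex \<Rightarrow> real" where
  "pc_sqnorm z = (PRe z)\<^sup>2 - (PIm z)\<^sup>2"

instantiation pcomplex :: comm_ring_1
begin

definition "0 = PComplex 0 0"
definition "1 = PComplex 1 0"
definition "x + y = PComplex (PRe x + PRe y) (PIm x + PIm y)"
definition "x - y = PComplex (PRe x - PRe y) (PIm x - PIm y)"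
definition "- x = PComplex (- PRe x) (- PIm x)"
definition "x * y = PComplex (PRe x * PRe y + PIm x * PIm y) (PRe x * PIm y + PIm x * PRe y)"

lemma PRe_PIm_simps [simp]:
  "PRe 0 = 0" "PIm 0 = 0" "PRe 1 = 1" "PIm 1 = 0"
  "PRe (x + y) = PRe x + PRe y" "PIm (x + y) = PIm x + PIm y"
  "PRe (x - y) = PRe x - PRe y" "PIm (x - y) = PIm x - PIm y"
  "PRe (- x) = - PRe x" "PIm (- x) = - PIm x"
  "PRe (x * y) = PRe x * PRe y + PIm x * PIm y"
  "PIm (x * y) = PRe x * PIm y + PIm x * PRe y"
  by (simp_all add: zero_pcomplex_def one_pcomplex_def plus_pcomplex_def minus_pcomplex_def
      uminus_pcomplex_def times_pcomplex_def)

instance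
  by standard (auto simp: pcomplex_eq_iff algebra_simps)

end

text \<open>There are zero divisors, so this is no division ring; \<open>inverse z\<close> is the multiplicative
  inverse (conjugate over \<open>pc_sqnorm\<close>) exactly when \<open>pc_sqnorm z \<noteq> 0\<close>.\<close>

instantiation pcomplex :: inverse
begin

definition "inverse z = PComplex (PRe z / pc_sqnorm z) (- PIm z / pc_sqnorm z)"
definition "x div y = x * inverse (y :: pcomplex)"

instance ..

end

lemma pcomplex_inverse_right: "pc_sqnorm z \<noteq> 0 \<Longrightarrow> z * inverse z = 1"
  by (simp add: pcomplex_eq_iff inverse_pcomplex_def diff_divide_distrib [symmetric])
    (simp add: pc_sqnorm_def power2_eq_square)

text \<open>The norm only serves to give the type its usual topology as a two-dimensional real vector
  space (the sum norm is submultiplicative); it is unrelated to \<open>pc_sqnorm\<close>.\<close>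

instantiation pcomplex :: real_normed_algebra_1
begin

definition "scaleR r z = PComplex (r * PRe z) (r * PIm z)"
definition "norm z = \<bar>PRe z\<bar> + \<bar>PIm z\<bar>"
definition "sgn z = inverse (norm z) *\<^sub>R (z :: pcomplex)"
definition "dist x y = norm (x - y :: pcomplex)"
definition "(uniformity :: (pcomplex \<times> pcomplex) filter) =
  (INF e\<in>{0 <..}. principal {(x, y). dist x y < e})"
definition "open (U :: pcomplex set) \<longleftrightarrow>
  (\<forall>x\<in>U. eventually (\<lambda>(x', y). x' = x \<longrightarrow> y \<in> U) uniformity)"

instance
proof
  fix r s :: real and x y :: pcomplex
  show "r *\<^sub>R (x + y) = r *\<^sub>R x + r *\<^sub>R y" "(r + s) *\<^sub>R x = r *\<^sub>R x + s *\<^sub>R x"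
    "r *\<^sub>R s *\<^sub>R x = (r * s) *\<^sub>R x" "1 *\<^sub>R x = x"
    "r *\<^sub>R x * y = r *\<^sub>R (x * y)" "x * r *\<^sub>R y = r *\<^sub>R (x * y)"
    by (simp_all add: pcomplex_eq_iff scaleR_pcomplex_def algebra_simps)
  show "norm x = 0 \<longleftrightarrow> x = 0"
    by (auto simp: norm_pcomplex_def pcomplex_eq_iff)
  show "norm (x + y) \<le> norm x + norm y"
    by (simp add: norm_pcomplex_def)
  show "norm (r *\<^sub>R x) = \<bar>r\<bar> * norm x"
    by (simp add: norm_pcomplex_def scaleR_pcomplex_def abs_mult distrib_left)
  show "norm (x * y) \<le> norm x * norm y"
  proof -
    have "\<bar>PRe x * PRe y + PIm x * PIm y\<bar> \<le> \<bar>PRe x\<bar> * \<bar>PRe y\<bar> + \<bar>PIm x\<bar> * \<bar>PIm y\<bar>"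
      "\<bar>PRe x * PIm y + PIm x * PRe y\<bar> \<le> \<bar>PRe x\<bar> * \<bar>PIm y\<bar> + \<bar>PIm x\<bar> * \<bar>PRe y\<bar>"
      by (metis abs_mult abs_triangle_ineq)+
    then show ?thesis
      by (simp add: norm_pcomplex_def algebra_simps)
  qed
  show "norm (1 :: pcomplex) = 1"
    by (simp add: norm_pcomplex_def)
qed (rule sgn_pcomplex_def dist_pcomplex_def uniformity_pcomplex_def open_pcomplex_def)+

end


section \<open>Topological ideal triangulations\<close>

datatype vertex = V1 | V2 | V3 | V4

lemma UNIV_vertex: "UNIV = {V1, V2, V3, V4}"
  using vertex.exhaust by auto

instance vertex :: finite
  by standard (simp add: UNIV_vertex)

text \<open>The tetrahedra are indexed by a finite type \<open>'n\<close>, so that \<open>N = CARD('n)\<close>.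
  \<open>G j k = (j', p)\<close> says that the face of tetrahedron \<open>j\<close> opposite to its vertex \<open>k\<close> is glued
  to the face of tetrahedron \<open>j'\<close> opposite to \<open>p k\<close>, by the affine map sending each vertex
  \<open>i \<noteq> k\<close> to \<open>p i\<close>.  Every face is glued, so every edge is interior.\<close>

type_synonym 'n gluing = "'n \<Rightarrow> vertex \<Rightarrow> 'n \<times> (vertex \<Rightarrow> vertex)"

text \<open>That every \<open>p\<close> is odd means that each gluing map reverses the orientations which the
  vertex orderings \<open>V1, V2, V3, V4\<close> induce on the two faces, i.e. that these orderings are all
  compatible with one orientation of the glued-up manifold.\<close>

definition oriented_gluing :: "'n gluing \<Rightarrow> bool" where
  "oriented_gluing G \<longleftrightarrow> (\<forall>j k j' p. G j k = (j', p) \<longrightarrow>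
     bij p \<and> \<not> evenperm p \<and> (j', p k) \<noteq> (j, k) \<and> G j' (p k) = (j, inv p))"

text \<open>A tetrahedron with its vertices removed, in barycentric coordinates.\<close>

definition ideal_tetrahedron :: "(real ^ vertex) set" where
  "ideal_tetrahedron = {x. (\<forall>i. 0 \<le> x $ i) \<and> (\<Sum>i\<in>UNIV. x $ i) = 1 \<and> (\<forall>i. x $ i \<noteq> 1)}"

definition disjoint_tetrahedra :: "('n \<times> (real ^ vertex)) topology" where
  "disjoint_tetrahedra = prod_topology (discrete_topology UNIV) (top_of_set ideal_tetrahedron)"

definition face_glued :: "'n gluing \<Rightarrow> 'n \<times> (real ^ vertex) \<Rightarrow> 'n \<times> (real ^ vertex) \<Rightarrow> bool" where
  "face_glued G a b \<longleftrightarrow> (\<exists>k. snd a $ k = 0 \<and>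
     (case G (fst a) k of (j', p) \<Rightarrow> b = (j', \<chi> i. snd a $ inv p i)))"

definition manifold_interior :: "'m topology \<Rightarrow> 'm set" where
  "manifold_interior M = {x \<in> topspace M. \<exists>U. openin M U \<and> x \<in> U \<and>
     subtopology M U homeomorphic_space (euclidean :: (real ^ 3) topology)}"

definition manifold_boundary :: "'m topology \<Rightarrow> 'm set" where
  "manifold_boundary M = topspace M - manifold_interior M"

definition three_manifold_with_boundary :: "'m topology \<Rightarrow> bool" where
  "three_manifold_with_boundary M \<longleftrightarrow> Hausdorff_space M \<and> second_countable M \<and>
     (\<forall>x\<in>topspace M. \<exists>U V. openin M U \<and> x \<in> U \<and>
        openin (top_of_set {y :: real ^ 3. 0 \<le> y $ 1}) V \<and>
        subtopology M U homeomorphic_space top_of_set V)"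

definition boundary_union_of_tori :: "'m topology \<Rightarrow> bool" where
  "boundary_union_of_tori M \<longleftrightarrow>
     (\<forall>C\<in>connected_components_of (subtopology M (manifold_boundary M)).
        subtopology M C homeomorphic_space
          top_of_set (sphere (0 :: complex) 1 \<times> sphere (0 :: complex) 1))"

text \<open>As usual for a three-manifold bounded by tori, \<open>M\<close> is the compact manifold and it is its
  interior that is the union of the tetrahedra without their vertices.  The orientation of \<open>M\<close>
  is carried by \<open>oriented_gluing\<close>.\<close>

definition triangulated_three_manifold :: "'m topology \<Rightarrow> 'n::finite gluing \<Rightarrow> bool" where
  "triangulated_three_manifold M G \<longleftrightarrow>
     compact_space M \<and> three_manifold_with_boundary M \<and> boundary_union_of_tori M \<and>
     oriented_gluing G \<and>
     (\<exists>q. quotient_map disjoint_tetrahedra (subtopology M (manifold_interior M)) q \<and>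
        (\<forall>a \<in> topspace disjoint_tetrahedra. \<forall>b \<in> topspace disjoint_tetrahedra.
           q a = q b \<longleftrightarrow> equivclp (face_glued G) a b))"

text \<open>An edge of a tetrahedron is a pair \<open>(j, e)\<close> with \<open>e\<close> a two-element set of vertices; an edge
  of the triangulation is the class of all tetrahedron edges identified to it.\<close>

definition tetrahedron_edges :: "('n \<times> vertex set) set" where
  "tetrahedron_edges = {(j, e). card e = 2}"

definition edge_glued :: "'n gluing \<Rightarrow> 'n \<times> vertex set \<Rightarrow> 'n \<times> vertex set \<Rightarrow> bool" where
  "edge_glued G a b \<longleftrightarrow> (\<exists>k. k \<notin> snd a \<and>
     (case G (fst a) k of (j', p) \<Rightarrow> b = (j', p ` snd a)))"

definition edges :: "'n gluing \<Rightarrow> ('n \<times> vertex set) set set" where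
  "edges G = tetrahedron_edges // {(a, b). equivclp (edge_glued G) a b}"


section \<open>Thurston's equations\<close>

definition edge_shape :: "'a::{comm_ring_1, inverse} \<Rightarrow> vertex set \<Rightarrow> 'a" where
  "edge_shape z e =
     (if e \<in> {{V1, V2}, {V3, V4}} then z
      else if e \<in> {{V1, V3}, {V2, V4}} then 1 / (1 - z)
      else (z - 1) / z)"

definition edge_equations :: "'n::finite gluing \<Rightarrow> 'a::{comm_ring_1, inverse} ^ 'n \<Rightarrow> bool" where
  "edge_equations G z \<longleftrightarrow> (\<forall>E\<in>edges G. (\<Prod>(j, e)\<in>E. edge_shape (z $ j) e) = 1)"

definition thurston_real :: "'n::finite gluing \<Rightarrow> real ^ 'n \<Rightarrow> bool" where
  "thurston_real G z \<longleftrightarrow> (\<forall>j. z $ j \<noteq> 0 \<and> z $ j \<noteq> 1) \<and> edge_equations G z \<and>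
     (\<forall>E\<in>edges G. card {(j, e) \<in> E. edge_shape (z $ j) e < 0} = 2)"

definition thurston_complex :: "'n::finite gluing \<Rightarrow> complex ^ 'n \<Rightarrow> bool" where
  "thurston_complex G z \<longleftrightarrow> (\<forall>j. z $ j \<noteq> 0 \<and> z $ j \<noteq> 1) \<and> edge_equations G z \<and>
     (\<forall>E\<in>edges G. (\<Sum>(j, e)\<in>E. Arg (edge_shape (z $ j) e)) = 2 * pi)"

definition thurston_pcomplex :: "'n::finite gluing \<Rightarrow> pcomplex ^ 'n \<Rightarrow> bool" where
  "thurston_pcomplex G z \<longleftrightarrow>
     (\<forall>j. pc_sqnorm (z $ j) > 0 \<and> pc_sqnorm (1 - z $ j) > 0) \<and> edge_equations G z \<and>
     (\<forall>E\<in>edges G. card {(j, e) \<in> E. PRe (edge_shape (z $ j) e) < 0} = 2)"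

definition real_deformation_variety :: "'n::finite gluing \<Rightarrow> (real ^ 'n) set" where
  "real_deformation_variety G = {z. thurston_real G z}"


section \<open>Geometric structures on the triangulated manifold\<close>

text \<open>The structures on \<open>(M, T)\<close> are those glued from ideal quadrilaterals or ideal tetrahedra with
  prescribed shapes, so each is represented by its tuple of shape parameters.  When all imaginary
  parts are positive, \<open>Arg\<close> of every edge shape lies in $(0,\pi)$.\<close>

definition transversely_hyperbolic_foliation :: "'n::finite gluing \<Rightarrow> real ^ 'n \<Rightarrow> bool" where
  "transversely_hyperbolic_foliation G z \<longleftrightarrow> thurston_real G z"

definition hyperbolic_structure :: "'n::finite gluing \<Rightarrow> complex ^ 'n \<Rightarrow> bool" where
  "hyperbolic_structure G z \<longleftrightarrow> thurston_complex G z \<and> (\<forall>j. Im (z $ j) > 0)"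

definition AdS_structure :: "'n::finite gluing \<Rightarrow> pcomplex ^ 'n \<Rightarrow> bool" where
  "AdS_structure G z \<longleftrightarrow> thurston_pcomplex G z \<and> (\<forall>j. PIm (z $ j) > 0)"

definition collapses_to :: "(real \<Rightarrow> 'a::real_normed_algebra_1 ^ 'n::finite) \<Rightarrow> real ^ 'n \<Rightarrow> bool"
  where "collapses_to S z \<longleftrightarrow> continuous_on {0<..} S \<and>
     (S \<longlongrightarrow> (\<chi> j. of_real (z $ j))) (at_right 0)"


section \<open>Smooth submanifolds\<close>

primrec Ck_on :: "nat \<Rightarrow> ('a::real_normed_vector \<Rightarrow> 'b::real_normed_vector) \<Rightarrow> 'a set \<Rightarrow> bool" where
  "Ck_on 0 f U \<longleftrightarrow> continuous_on U f"
| "Ck_on (Suc k) f U \<longleftrightarrow> (\<forall>x\<in>U. f differentiable (at x)) \<and>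
     (\<forall>h. Ck_on k (\<lambda>x. frechet_derivative f (at x) h) U)"

definition smooth_on :: "'a::euclidean_space set \<Rightarrow> ('a \<Rightarrow> 'b::euclidean_space) \<Rightarrow> bool" where
  "smooth_on U f \<longleftrightarrow> open U \<and> (\<forall>k. Ck_on k f U)"

definition embedded_submanifold :: "nat \<Rightarrow> 'a::euclidean_space set \<Rightarrow> bool" where
  "embedded_submanifold d S \<longleftrightarrow> (\<forall>p\<in>S. \<exists>U V \<phi> \<psi> L.
     p \<in> U \<and> smooth_on U \<phi> \<and> smooth_on V \<psi> \<and> homeomorphism U V \<phi> \<psi> \<and>
     subspace (L :: 'a set) \<and> dim L = d \<and> \<phi> ` (S \<inter> U) = V \<inter> L)"

definition smooth_at :: "'a::euclidean_space set \<Rightarrow> 'a \<Rightarrow> bool" where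
  "smooth_at S p \<longleftrightarrow> p \<in> S \<and> (\<exists>U d. open U \<and> p \<in> U \<and> embedded_submanifold d (S \<inter> U))"

definition tangent_vector :: "'a::euclidean_space set \<Rightarrow> 'a \<Rightarrow> 'a \<Rightarrow> bool" where
  "tangent_vector S p v \<longleftrightarrow> (\<exists>c \<epsilon>. \<epsilon> > 0 \<and> smooth_on {- \<epsilon><..<\<epsilon>} c \<and> c ` {- \<epsilon><..<\<epsilon>} \<subseteq> S \<and>
     c 0 = p \<and> (c has_vector_derivative v) (at (0 :: real)))"

end

theory Submission
  imports Defs
begin

text \<open>
Write a shape parameter near the real solution \<open>z\<close> as \<open>x = z e\<^sup>p\<close> with \<open>1 - x = (1 - z) e\<^sup>q\<close>.  The shape at
an edge is then its real value times the exponential of \<open>p\<close>, \<open>- q\<close> or \<open>q - p\<close>, so the edge equations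
become linear: \<open>(p, q)\<close> has to lie in a subspace \<open>W\<close> given by one linear form for each edge
(\<open>log_edge_space\<close>).  The nonlinearity moves into the equations \<open>z e\<^sup>p + (1 - z) e\<^sup>q = 1\<close>, one for each
tetrahedron (\<open>closing_defect\<close>).

Hyperbolic structures.  Along a curve of real solutions with velocity \<open>v\<close>, the logarithms \<open>(p, q)\<close> have
a first Taylor coefficient \<open>a\<close> and a second one \<open>b\<close>, both in \<open>W\<close> (\<open>log_jet_of_curve\<close>).  The same
polynomial taken at the imaginary time \<open>i\<tau>\<close>, namely \<open>i\<tau>a - \<tau>\<^sup>2b\<close>, satisfies the edge equations exactly
and the closing equations up to \<open>O(\<tau>\<^sup>3)\<close>, and its shapes are \<open>z + i\<tau>v + O(\<tau>\<^sup>2)\<close>.  To remove the error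
one moves inside \<open>W\<close>.  The differential of the closing equations may be degenerate at \<open>z\<close> itself, but
the symplectic relation of Neumann and Zagier between the edge equations (\<open>neumann_zagier\<close>)
provides a Lagrangian subspace \<open>P\<close> of \<open>W\<close>.  On the complexification of \<open>P\<close> the Hermitian form
\<open>\<Sum> Im (p\<^sub>j cnj q\<^sub>j)\<close> vanishes, and this forces the differential at \<open>z + i\<tau>v\<close> to be invertible there
and bounded below by a multiple of \<open>\<tau>\<close> (\<open>shape_differential_bounded_below\<close>,
\<open>shape_differential_surj\<close>): this is where \<open>v > 0\<close> enters.  An error \<open>O(\<tau>\<^sup>3)\<close> is small
compared with the square of that bound, so a contraction finds an exact solution within \<open>\<epsilon>\<tau>\<close>, for a fixed
small \<open>\<epsilon>\<close>, and it depends continuously on \<open>\<tau>\<close> (\<open>lagrangian_deformation\<close>).  The imaginary parts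
\<open>\<tau>v + O(\<epsilon>\<tau>)\<close> remain positive.  The arguments of the shapes at an edge are \<open>0\<close> or \<open>\<pi>\<close> plus the imaginary
parts of the linear forms; the latter add up to zero, and \<open>\<pi>\<close> occurs exactly twice, so the
dihedral angles sum to \<open>2\<pi>\<close> (\<open>hyperbolic_structure_of_logs\<close>).

AdS structures.  The ring \<open>\<real> + \<real>\<tau>\<close> is \<open>\<real> \<times> \<real>\<close> via the two maps \<open>a + b\<tau> \<mapsto> a \<plusminus> b\<close>, so a solution over it is
a pair of real solutions (\<open>AdS_structure_of_real_pair\<close>).  The pair \<open>(c t, z)\<close>, for a curve \<open>c\<close> with velocity
\<open>v > 0\<close> at \<open>c 0 = z\<close>, has positive imaginary parts for small \<open>t > 0\<close>.
\<close>


section \<open>The symplectic relation between edges\<close>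

text \<open>The shape at \<open>e\<close> is multiplied by \<open>exp (fst (log_coeff e) * p + snd (log_coeff e) * q)\<close> when \<open>z\<close> is
multiplied by \<open>exp p\<close> and \<open>1 - z\<close> by \<open>exp q\<close>.\<close>

definition log_coeff :: "vertex set \<Rightarrow> real \<times> real" where
  "log_coeff e = (if e \<in> {{V1, V2}, {V3, V4}} then (1, 0)
     else if e \<in> {{V1, V3}, {V2, V4}} then (0, - 1) else (- 1, 1))"

definition wedge :: "real \<times> real \<Rightarrow> real \<times> real \<Rightarrow> real" where
  "wedge u w = fst u * snd w - snd u * fst w"

lemma card_2_vertex_cases:
  assumes "card (e :: vertex set) = 2"
  shows "e \<in> {{V1, V2}, {V3, V4}, {V1, V3}, {V2, V4}, {V1, V4}, {V2, V3}}"
proof -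
  obtain a b where "e = {a, b}" "a \<noteq> b" using assms by (auto simp: card_2_iff)
  then show ?thesis by (cases a; cases b) (auto simp: doubleton_eq_iff)
qed

lemma log_coeff_simps:
  "log_coeff {V1, V2} = (1, 0)" "log_coeff {V2, V1} = (1, 0)"
  "log_coeff {V3, V4} = (1, 0)" "log_coeff {V4, V3} = (1, 0)"
  "log_coeff {V1, V3} = (0, - 1)" "log_coeff {V3, V1} = (0, - 1)"
  "log_coeff {V2, V4} = (0, - 1)" "log_coeff {V4, V2} = (0, - 1)"
  "log_coeff {V1, V4} = (- 1, 1)" "log_coeff {V4, V1} = (- 1, 1)"
  "log_coeff {V2, V3} = (- 1, 1)" "log_coeff {V3, V2} = (- 1, 1)"
  by (simp_all add: log_coeff_def doubleton_eq_iff)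

text \<open>A transposition of the vertices fixes one of the three pairs of opposite edges and exchanges the other
two.  The coefficients of the three pairs add up to zero and span the plane, so the exchange is induced
by a linear map, of determinant \<open>- 1\<close>.\<close>

definition reflection :: "vertex \<Rightarrow> vertex \<Rightarrow> real \<times> real \<Rightarrow> real \<times> real" where
  "reflection a b u =
     (if {a, b} \<in> {{V1, V2}, {V3, V4}} then (fst u + snd u, - snd u)
      else if {a, b} \<in> {{V1, V3}, {V2, V4}} then (- fst u, fst u + snd u)
      else (- snd u, - fst u))"

lemma log_coeff_transpose:
  assumes "a \<noteq> b" "card e = 2"
  shows "log_coeff (Transposition.transpose a b ` e) = reflection a b (log_coeff e)"
proof -
  have "log_coeff (Transposition.transpose a b ` {c, d}) = reflection a b (log_coeff {c, d})"
    if "c \<noteq> d" for c d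
    unfolding reflection_def using assms(1) that
    by (cases a; cases b; simp add: doubleton_eq_iff;
        cases c; cases d; simp add: Transposition.transpose_def log_coeff_simps)
  then show ?thesis using assms(2) by (auto simp: card_2_iff)
qed

lemma wedge_reflection: "wedge (reflection a b u) (reflection a b w) = - wedge u w"
  by (simp add: reflection_def wedge_def algebra_simps)

text \<open>A permutation is a product of transpositions, and each of them acts on the coefficients by a reflection,
which reverses the wedge.\<close>

lemma wedge_log_coeff_permutes:
  assumes "p permutes (UNIV :: vertex set)" "card e = 2" "card e' = 2"
  shows "wedge (log_coeff (p ` e)) (log_coeff (p ` e'))
    = of_int (sign p) * wedge (log_coeff e) (log_coeff e')"
  using assms(1) finite
proof (induction rule: permutes_induct)
  case id
  show ?case by simp
next
  case (swap a b p)
  have inj: "inj p" using swap.hyps(4) by (rule permutes_inj)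
  have "card (p ` e) = 2" "card (p ` e') = 2"
    using assms card_image[OF inj_on_subset[OF inj]] by auto
  moreover have "sign (Transposition.transpose a b \<circ> p) = - sign p"
    using swap.hyps sign_compose[OF permutation_swap_id, of p a b]
    by (auto simp: sign_swap_id permutation_permutes)
  ultimately show ?case
    using swap.IH unfolding image_comp[symmetric]
    by (simp add: log_coeff_transpose[OF \<open>a \<noteq> b\<close>] wedge_reflection del: o_apply o_def)
qed

text \<open>Edges whose wedge is nonzero are distinct and not opposite, so they span exactly one face, the one that
misses the vertex \<open>k\<close>.  This distributes the wedge over the faces.\<close>

lemma sum_common_faces_wedge:
  assumes "card e = 2" "card e' = 2"
  shows "(\<Sum>k\<in>UNIV. if k \<notin> e \<and> k \<notin> e' then wedge (log_coeff e) (log_coeff e') else 0)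
    = wedge (log_coeff e) (log_coeff e')"
  using card_2_vertex_cases[OF assms(1)] card_2_vertex_cases[OF assms(2)]
  by (elim insertE emptyE; simp add: wedge_def log_coeff_simps UNIV_vertex)

lemma edge_class_card:
  assumes G: "oriented_gluing G" and E: "E \<in> edges G" and je: "(j, e) \<in> E"
  shows "card e = 2"
proof -
  obtain a where a: "a \<in> tetrahedron_edges" "equivclp (edge_glued G) a (j, e)"
    using E je by (auto simp: edges_def quotient_def)
  from a(2) have "card (snd a) = card (snd (j, e))"
  proof (induction rule: equivclp_induct)
    case base
    show ?case by simp
  next
    case (step y z)
    have "card (snd c) = card (snd b)" if bc: "edge_glued G b c" for b c
    proof -
      from bc have "\<exists>k. c = (fst (G (fst b) k), snd (G (fst b) k) ` snd b)"
        by (auto simp: edge_glued_def case_prod_beta)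
      then obtain k j' p where k: "G (fst b) k = (j', p)" "c = (j', p ` snd b)"
        by (metis prod.collapse)
      then have "inj p" using G by (auto simp: oriented_gluing_def bij_is_inj)
      then show ?thesis using k by (simp add: card_image inj_on_subset)
    qed
    then show ?case using step by metis
  qed
  then show ?thesis using a(1) by (auto simp: tetrahedron_edges_def)
qed

lemma edge_class_glued:
  assumes E: "E \<in> edges G" and je: "(j, e) \<in> E" and k: "k \<notin> e" and Gjk: "G j k = (j', p)"
  shows "(j', p ` e) \<in> E"
proof -
  have "edge_glued G (j, e) (j', p ` e)"
    unfolding edge_glued_def using k Gjk by auto
  then show ?thesis using E je
    by (auto simp: edges_def quotient_def intro: equivclp_into_equivclp)
qed

text \<open>The face \<open>(j, k)\<close> of the tetrahedron \<open>j\<close> is the one opposite to its vertex \<open>k\<close>.\<close>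

definition face_edges :: "('n \<times> vertex set) set \<Rightarrow> 'n \<times> vertex \<Rightarrow> vertex set set" where
  "face_edges E f = {e. (fst f, e) \<in> E \<and> snd f \<notin> e}"

lemma bij_betw_face_edges:
  assumes G: "oriented_gluing G" and E: "E \<in> edges G" and Gjk: "G j k = (j', p)"
  shows "bij_betw ((`) p) (face_edges E (j, k)) (face_edges E (j', p k))"
proof (rule bij_betw_byWitness[where f' = "(`) (inv p)"])
  have p: "bij p" and Gj': "G j' (p k) = (j, inv p)"
    using G Gjk by (auto simp: oriented_gluing_def)
  show "\<forall>e\<in>face_edges E (j, k). inv p ` p ` e = e"
    using p by (simp add: bij_is_inj image_inv_f_f)
  show "\<forall>e\<in>face_edges E (j', p k). p ` inv p ` e = e"
    using p by (simp add: bij_is_surj image_f_inv_f)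
  show "(`) p ` face_edges E (j, k) \<subseteq> face_edges E (j', p k)"
    using edge_class_glued[OF E _ _ Gjk] inj_image_mem_iff[OF bij_is_inj[OF p]]
    by (auto simp: face_edges_def)
  show "(`) (inv p) ` face_edges E (j', p k) \<subseteq> face_edges E (j, k)"
    using edge_class_glued[OF E _ _ Gj'] p
    by (auto simp: face_edges_def bij_is_inj bij_is_surj surj_f_inv_f)
qed

text \<open>By \<open>sum_common_faces_wedge\<close> the sum is a sum over the faces of all tetrahedra.  Glued faces carry the same
edges, identified by an odd map, so their contributions are opposite to each other; the gluing is an
involution on the set of faces, and everything cancels.\<close>

lemma neumann_zagier:
  fixes G :: "'n::finite gluing"
  assumes G: "oriented_gluing G" and E: "E \<in> edges G" and E': "E' \<in> edges G"
  shows "(\<Sum>j\<in>UNIV. \<Sum>e | (j, e) \<in> E. \<Sum>e' | (j, e') \<in> E'. wedge (log_coeff e) (log_coeff e')) = 0"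
    (is "?S = 0")
proof -
  define T where "T f = (\<Sum>e\<in>face_edges E f. \<Sum>e'\<in>face_edges E' f.
    wedge (log_coeff e) (log_coeff e'))" for f
  define g where "g f = (case G (fst f) (snd f) of (j', p) \<Rightarrow> (j', p (snd f)))" for f
  have gg: "g (g f) = f" for f
  proof -
    obtain j' p where "G (fst f) (snd f) = (j', p)" by fastforce
    then show ?thesis using G by (auto simp: g_def oriented_gluing_def bij_is_inj)
  qed
  have Tg: "T (g f) = - T f" for f
  proof -
    obtain j k where f: "f = (j, k)" by fastforce
    obtain j' p where p: "G j k = (j', p)" by fastforce
    have bp: "bij p" "\<not> evenperm p" using G p by (auto simp: oriented_gluing_def)
    have pp: "p permutes UNIV" using bp by (simp add: permutes_univ bij_iff)
    have "T (g f) = (\<Sum>e\<in>face_edges E (j', p k). \<Sum>e'\<in>face_edges E' (j', p k).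
        wedge (log_coeff e) (log_coeff e'))"
      by (simp add: T_def g_def f p)
    also have "\<dots> = (\<Sum>e\<in>face_edges E f. \<Sum>e'\<in>face_edges E' f.
        wedge (log_coeff (p ` e)) (log_coeff (p ` e')))"
      unfolding f sum.reindex_bij_betw[OF bij_betw_face_edges[OF G E p], symmetric]
        sum.reindex_bij_betw[OF bij_betw_face_edges[OF G E' p], symmetric] ..
    also have "\<dots> = (\<Sum>e\<in>face_edges E f. \<Sum>e'\<in>face_edges E' f.
        - wedge (log_coeff e) (log_coeff e'))"
    proof (intro sum.cong refl)
      fix e e' assume "e \<in> face_edges E f" "e' \<in> face_edges E' f"
      then have "card e = 2" "card e' = 2"
        using edge_class_card[OF G E] edge_class_card[OF G E'] by (auto simp: face_edges_def)
      then show "wedge (log_coeff (p ` e)) (log_coeff (p ` e')) = - wedge (log_coeff e) (log_coeff e')"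
        using bp by (simp add: wedge_log_coeff_permutes[OF pp] sign_def)
    qed
    finally show ?thesis by (simp add: T_def sum_negf)
  qed
  have "(\<Sum>f\<in>UNIV. T f) = (\<Sum>f\<in>UNIV. T (g f))"
    by (rule sum.reindex_bij_witness[of _ g g]) (auto simp: gg)
  then have T0: "(\<Sum>f\<in>UNIV. T f) = 0" by (simp add: Tg sum_negf)
  have T: "T (j, k) = (\<Sum>e | (j, e) \<in> E. \<Sum>e' | (j, e') \<in> E'.
      if k \<notin> e \<and> k \<notin> e' then wedge (log_coeff e) (log_coeff e') else 0)" for j k
  proof -
    have F: "(\<Sum>e\<in>face_edges E (j, k). h e) = (\<Sum>e | (j, e) \<in> E. if k \<notin> e then h e else 0)"
      for E and h :: "vertex set \<Rightarrow> real"
      by (simp add: face_edges_def sum.inter_filter[symmetric])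
    show ?thesis unfolding T_def F by (intro sum.cong refl) (auto intro!: sum.cong)
  qed
  have "?S = (\<Sum>j\<in>UNIV. \<Sum>e | (j, e) \<in> E. \<Sum>e' | (j, e') \<in> E'. \<Sum>k\<in>UNIV.
      if k \<notin> e \<and> k \<notin> e' then wedge (log_coeff e) (log_coeff e') else 0)"
    using edge_class_card[OF G E] edge_class_card[OF G E']
    by (intro sum.cong refl) (simp add: sum_common_faces_wedge)
  also have "\<dots> = (\<Sum>j\<in>UNIV. \<Sum>e | (j, e) \<in> E. \<Sum>k\<in>UNIV. \<Sum>e' | (j, e') \<in> E'.
      if k \<notin> e \<and> k \<notin> e' then wedge (log_coeff e) (log_coeff e') else 0)"
    by (rule sum.cong[OF refl], rule sum.cong[OF refl], rule sum.swap)
  also have "\<dots> = (\<Sum>j\<in>UNIV. \<Sum>k\<in>UNIV. T (j, k))"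
    unfolding T by (rule sum.cong[OF refl], rule sum.swap)
  also have "\<dots> = 0" using T0 by (simp add: sum.cartesian_product UNIV_Times_UNIV)
  finally show ?thesis .
qed

section \<open>Lagrangian subspaces and the closing differential\<close>

definition symplectic_form :: "'a::euclidean_space \<times> 'a \<Rightarrow> 'a \<times> 'a \<Rightarrow> real" where
  "symplectic_form u w = fst u \<bullet> snd w - snd u \<bullet> fst w"

lemma symplectic_form_simps:
  "symplectic_form (u + u') w = symplectic_form u w + symplectic_form u' w" "symplectic_form u (w + w') = symplectic_form u w + symplectic_form u w'"
  "symplectic_form (c *\<^sub>R u) w = c * symplectic_form u w" "symplectic_form u (c *\<^sub>R w) = c * symplectic_form u w"
  "symplectic_form 0 w = 0" "symplectic_form u 0 = 0" "symplectic_form u u = 0"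
  by (simp_all add: symplectic_form_def algebra_simps inner_commute)

lemma symplectic_form_skew: "symplectic_form u w = - symplectic_form w u"
  by (simp add: symplectic_form_def inner_commute)

definition lagrangian :: "('a::euclidean_space \<times> 'a) set \<Rightarrow> bool" where
  "lagrangian P \<longleftrightarrow> P = {w. \<forall>u\<in>P. symplectic_form u w = 0}"

lemma lagrangian_isotropic: "lagrangian P \<Longrightarrow> u \<in> P \<Longrightarrow> w \<in> P \<Longrightarrow> symplectic_form u w = 0"
  and lagrangian_memI: "lagrangian P \<Longrightarrow> (\<And>u. u \<in> P \<Longrightarrow> symplectic_form u w = 0) \<Longrightarrow> w \<in> P"
  unfolding lagrangian_def by blast+

lemma subspace_lagrangian: "lagrangian P \<Longrightarrow> subspace P"
proof -
  assume "lagrangian P"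
  moreover have "subspace {w. \<forall>u\<in>P. symplectic_form u w = 0}"
    by (rule subspaceI) (auto simp: symplectic_form_simps)
  ultimately show "subspace P" unfolding lagrangian_def by metis
qed

text \<open>An isotropic subspace of maximal dimension is Lagrangian: a vector orthogonal to it but outside it could be
added.\<close>

lemma isotropic_extends_to_lagrangian:
  assumes K: "\<And>u w. u \<in> K \<Longrightarrow> w \<in> K \<Longrightarrow> symplectic_form u w = 0"
  obtains P where "lagrangian P" "K \<subseteq> P"
proof -
  define good where "good P \<longleftrightarrow> subspace P \<and> K \<subseteq> P \<and> (\<forall>u\<in>P. \<forall>w\<in>P. symplectic_form u w = 0)" for P
  have extend: "symplectic_form u w = 0" if L: "\<forall>u\<in>L. \<forall>w\<in>L. symplectic_form u w = 0" and "u \<in> span L" "w \<in> span L"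
    for L :: "('a \<times> 'a) set" and u w
  proof -
    have 1: "symplectic_form u' w' = 0" if "u' \<in> span L" "w' \<in> L" for u' w'
      using that(1) by (induction rule: span_induct_alt) (use L that(2) in \<open>simp_all add: symplectic_form_simps\<close>)
    show ?thesis using \<open>w \<in> span L\<close>
      by (induction rule: span_induct_alt) (use 1 \<open>u \<in> span L\<close> in \<open>simp_all add: symplectic_form_simps\<close>)
  qed
  have "good (span K)"
    unfolding good_def using extend[of K] K by (auto intro: span_base)
  then obtain P where P: "good P" and max: "\<And>Q. good Q \<Longrightarrow> dim Q \<le> dim P"
    using ex_has_greatest_nat[of good "span K" dim "Suc DIM('a \<times> 'a)"]
      dim_subset_UNIV less_Suc_eq_le by blast
  have "w \<in> P" if w: "\<And>u. u \<in> P \<Longrightarrow> symplectic_form u w = 0" for w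
  proof (rule ccontr)
    assume wP: "w \<notin> P"
    have "\<forall>u\<in>insert w P. \<forall>w'\<in>insert w P. symplectic_form u w' = 0"
      using P w symplectic_form_skew[of w] by (auto simp: good_def symplectic_form_simps)
    with P have "good (span (insert w P))"
      unfolding good_def using extend[of "insert w P"] span_superset[of "insert w P"] by blast
    from max[OF this] have "dim (insert w P) \<le> dim P" by (simp add: dim_span)
    moreover have "w \<notin> span P" using wP P by (metis good_def span_eq_iff)
    ultimately show False by (simp add: dim_insert)
  qed
  with P have "lagrangian P" unfolding lagrangian_def good_def by blast
  with P show thesis using that by (auto simp: good_def)
qed

definition re_pair :: "(complex ^ 'n) \<times> (complex ^ 'n) \<Rightarrow> (real ^ 'n::finite) \<times> (real ^ 'n)" where
  "re_pair u = (\<chi> j. Re (fst u $ j), \<chi> j. Re (snd u $ j))"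

definition im_pair :: "(complex ^ 'n) \<times> (complex ^ 'n) \<Rightarrow> (real ^ 'n::finite) \<times> (real ^ 'n)" where
  "im_pair u = (\<chi> j. Im (fst u $ j), \<chi> j. Im (snd u $ j))"

definition complexification ::
  "((real ^ 'n) \<times> (real ^ 'n)) set \<Rightarrow> ((complex ^ 'n::finite) \<times> (complex ^ 'n)) set" where
  "complexification P = {u. re_pair u \<in> P \<and> im_pair u \<in> P}"

lemma subspace_complexification:
  assumes "subspace P"
  shows "subspace (complexification P)"
proof (rule subspaceI)
  have *: "re_pair 0 = 0" "im_pair 0 = 0" "re_pair (x + y) = re_pair x + re_pair y"
    "im_pair (x + y) = im_pair x + im_pair y" "re_pair (c *\<^sub>R x) = c *\<^sub>R re_pair x"
    "im_pair (c *\<^sub>R x) = c *\<^sub>R im_pair x" for x y :: "(complex ^ 'n) \<times> (complex ^ 'n)" and c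
    by (simp_all add: re_pair_def im_pair_def prod_eq_iff vec_eq_iff)
  show "0 \<in> complexification P"
    using assms by (simp add: complexification_def * subspace_0)
  show "x + y \<in> complexification P" if "x \<in> complexification P" "y \<in> complexification P" for x y
    using assms that by (simp add: complexification_def * subspace_add)
  show "c *\<^sub>R x \<in> complexification P" if "x \<in> complexification P" for x c
    using assms that by (simp add: complexification_def * subspace_scale)
qed

text \<open>For a vector \<open>u\<close> of the complexification, the sum is the symplectic form of the two vectors
\<open>im_pair u\<close> and \<open>re_pair u\<close> of \<open>P\<close>.\<close>

lemma hermitian_isotropic:
  assumes P: "lagrangian P" and u: "u \<in> complexification P"
  shows "(\<Sum>j\<in>UNIV. Im (fst u $ j * cnj (snd u $ j))) = 0"
proof -
  have "symplectic_form (im_pair u) (re_pair u) = 0"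
    using P u by (intro lagrangian_isotropic) (auto simp: complexification_def)
  then show ?thesis
    by (simp add: symplectic_form_def re_pair_def im_pair_def inner_vec_def sum_subtractf[symmetric] algebra_simps)
qed

text \<open>The differential of \<open>(p, q) \<mapsto> z e\<^sup>p + (1 - z) e\<^sup>q\<close> at a point with \<open>z e\<^sup>p = x\<close> and \<open>(1 - z) e\<^sup>q = 1 - x\<close>.\<close>

definition shape_differential ::
  "complex ^ 'n \<Rightarrow> (complex ^ 'n) \<times> (complex ^ 'n) \<Rightarrow> complex ^ 'n::finite" where
  "shape_differential x u = (\<chi> j. x $ j * fst u $ j + (1 - x $ j) * snd u $ j)"

lemma linear_shape_differential: "linear (shape_differential x)"
  by (rule linearI) (simp_all add: shape_differential_def vec_eq_iff algebra_simps)

lemma norm_vec_mult_le: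
  fixes x s :: "complex ^ 'n::finite"
  assumes "\<And>j. cmod (x $ j) \<le> B" "0 \<le> B"
  shows "norm (\<chi> j. x $ j * s $ j) \<le> B * norm s"
proof -
  have "norm (\<chi> j. x $ j * s $ j) \<le> L2_set (\<lambda>j. B * norm (s $ j)) UNIV"
    unfolding norm_vec_def using assms
    by (intro L2_set_mono) (auto simp: norm_mult intro: mult_right_mono)
  then show ?thesis using assms by (simp add: norm_vec_def L2_set_right_distrib)
qed

text \<open>Put \<open>s = p - q\<close> and \<open>r = x p + (1 - x) q\<close>.  Then \<open>q = r - x s\<close> and \<open>p = q + s\<close>, hence
\<open>Im (p cnj q) = Im (s cnj r) + Im x \<bar>s\<bar>\<^sup>2\<close>.  The left hand side sums to zero, so \<open>\<mu> \<parallel>s\<parallel>\<^sup>2 \<le> \<parallel>s\<parallel> \<parallel>r\<parallel>\<close>, and \<open>s\<close>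
and \<open>r\<close> determine \<open>(p, q)\<close>.\<close>

lemma shape_differential_bounded_below:
  assumes P: "lagrangian P" and u: "u \<in> complexification P"
    and \<mu>: "0 < \<mu>" "\<mu> \<le> 1" "\<And>j. \<mu> \<le> Im (x $ j)"
    and B: "0 \<le> B" "\<And>j. cmod (x $ j) \<le> B"
  shows "\<mu> * norm u \<le> (2 * B + 3) * norm (shape_differential x u)"
proof -
  define r s where "r = shape_differential x u" and "s = fst u - snd u"
  have q: "snd u $ j = r $ j - x $ j * s $ j" and p: "fst u $ j = snd u $ j + s $ j" for j
    by (simp_all add: r_def s_def shape_differential_def algebra_simps)
  have key: "Im (fst u $ j * cnj (snd u $ j)) = Im (s $ j * cnj (r $ j)) + Im (x $ j) * (cmod (s $ j))\<^sup>2" for j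
  proof -
    have "fst u $ j * cnj (snd u $ j) = snd u $ j * cnj (snd u $ j) + s $ j * cnj (r $ j) - cnj (x $ j) * (s $ j * cnj (s $ j))"
      unfolding p by (simp add: algebra_simps) (simp add: q algebra_simps)
    then show ?thesis by (simp flip: complex_norm_square of_real_power)
  qed
  have "\<mu> * (norm s)\<^sup>2 = (\<Sum>j\<in>UNIV. \<mu> * (cmod (s $ j))\<^sup>2)"
    by (simp add: norm_vec_def L2_set_def sum_nonneg sum_distrib_left)
  also have "\<dots> \<le> (\<Sum>j\<in>UNIV. Im (x $ j) * (cmod (s $ j))\<^sup>2)"
    by (intro sum_mono mult_right_mono \<mu>) auto
  also have "\<dots> = (\<Sum>j\<in>UNIV. - Im (s $ j * cnj (r $ j)))"
    using hermitian_isotropic[OF P u] by (simp only: key sum.distrib sum_negf)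
  also have "\<dots> \<le> (\<Sum>j\<in>UNIV. norm (s $ j) * norm (r $ j))"
  proof (rule sum_mono)
    show "- Im (s $ j * cnj (r $ j)) \<le> norm (s $ j) * norm (r $ j)" for j
      using abs_Im_le_cmod[of "s $ j * cnj (r $ j)"] by (simp add: norm_mult abs_le_iff)
  qed
  also have "\<dots> \<le> norm s * norm r"
    unfolding norm_vec_def by (rule order_trans[OF _ L2_set_mult_ineq]) simp
  finally have s: "\<mu> * norm s \<le> norm r"
    by (cases "norm s = 0") (auto simp: power2_eq_square)
  have "snd u = r - (\<chi> j. x $ j * s $ j)" by (simp add: vec_eq_iff q)
  then have q_le: "norm (snd u) \<le> norm r + B * norm s"
    using norm_vec_mult_le[of x B s] B norm_triangle_ineq4[of r "\<chi> j. x $ j * s $ j"] by simp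
  have "fst u = snd u + s" by (simp add: s_def)
  then have p_le: "norm (fst u) \<le> norm (snd u) + norm s" by (metis norm_triangle_ineq)
  have "norm u \<le> norm (fst u) + norm (snd u)"
    using norm_Pair_le[of "fst u" "snd u"] by simp
  with p_le q_le have "norm u \<le> 2 * norm r + (2 * B + 1) * norm s" by (simp add: algebra_simps)
  then have "\<mu> * norm u \<le> \<mu> * (2 * norm r) + (2 * B + 1) * (\<mu> * norm s)"
    using \<mu> mult_left_mono[of "norm u" _ \<mu>] by (fastforce simp: algebra_simps)
  also have "\<dots> \<le> 1 * (2 * norm r) + (2 * B + 1) * norm r"
    using s \<mu> B by (intro add_mono mult_mono mult_left_mono) auto
  finally show ?thesis by (simp add: r_def algebra_simps)
qed

text \<open>A vector orthogonal to the image gives, for \<open>s\<close> its conjugate, the vector \<open>w = ((1 - x) s, - x s)\<close>, which is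
symplectically orthogonal to \<open>P\<close>.  As \<open>P\<close> is Lagrangian, \<open>w\<close> lies in its complexification, and there
\<open>\<Sum> Im x\<^sub>j \<bar>s\<^sub>j\<bar>\<^sup>2 = 0\<close>.\<close>

lemma shape_differential_surj:
  fixes x :: "complex ^ 'n::finite"
  assumes P: "lagrangian P" and x: "\<And>j. 0 < Im (x $ j)"
  shows "shape_differential x ` complexification P = UNIV"
proof (rule ccontr)
  let ?I = "shape_differential x ` complexification P"
  assume "?I \<noteq> UNIV"
  have sub: "subspace ?I"
    by (intro linear_subspace_image linear_shape_differential subspace_complexification
        subspace_lagrangian P)
  have "dim ?I < DIM(complex ^ 'n)"
  proof -
    have "dim ?I \<noteq> DIM(complex ^ 'n)"
      using \<open>?I \<noteq> UNIV\<close> sub by (metis dim_eq_full span_eq_iff)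
    then show ?thesis using dim_subset_UNIV[of ?I] by linarith
  qed
  then obtain a where a: "a \<noteq> 0" "\<And>y. y \<in> span ?I \<Longrightarrow> orthogonal a y"
    by (rule orthogonal_to_subspace_exists) blast
  define s where "s = (\<chi> j. cnj (a $ j))"
  define w where "w = (\<chi> j. (1 - x $ j) * s $ j, \<chi> j. - (x $ j * s $ j))"
  have orth: "(\<Sum>j\<in>UNIV. Re (s $ j * shape_differential x u $ j)) = 0"
    if "u \<in> complexification P" for u
    using a(2)[of "shape_differential x u"] that
    by (simp add: orthogonal_def inner_vec_def span_base s_def inner_complex_def)
  have symplectic_form_w: "symplectic_form u (re_pair w) = 0" "symplectic_form u (im_pair w) = 0" if u: "u \<in> P" for u
  proof -
    \<comment> \<open>Real multiples of \<open>u\<close> detect the real part of \<open>w\<close>, imaginary ones the imaginary part.\<close>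
    define v where "v c = (\<chi> j. of_real (fst u $ j) * c, \<chi> j. of_real (snd u $ j) * c)" for c :: complex
    have v: "v c \<in> complexification P" for c
    proof -
      have "re_pair (v c) = Re c *\<^sub>R u" "im_pair (v c) = Im c *\<^sub>R u"
        by (simp_all add: v_def re_pair_def im_pair_def prod_eq_iff vec_eq_iff)
      then show ?thesis
        using subspace_lagrangian[OF P] u by (simp add: complexification_def subspace_scale)
    qed
    have "symplectic_form u (re_pair w) = - (\<Sum>j\<in>UNIV. Re (s $ j * shape_differential x (v 1) $ j))"
      by (simp add: symplectic_form_def re_pair_def w_def inner_vec_def shape_differential_def v_def
          sum_subtractf[symmetric] sum_negf[symmetric] algebra_simps)
    then show "symplectic_form u (re_pair w) = 0" using orth[OF v[of 1]] by simp
    have "symplectic_form u (im_pair w) = (\<Sum>j\<in>UNIV. Re (s $ j * shape_differential x (v \<i>) $ j))"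
      by (simp add: symplectic_form_def im_pair_def w_def inner_vec_def shape_differential_def v_def
          sum_subtractf[symmetric] algebra_simps)
    then show "symplectic_form u (im_pair w) = 0" using orth[OF v[of \<i>]] by simp
  qed
  then have "re_pair w \<in> P" "im_pair w \<in> P"
    using P by (auto intro: lagrangian_memI)
  then have "(\<Sum>j\<in>UNIV. Im (fst w $ j * cnj (snd w $ j))) = 0"
    by (intro hermitian_isotropic[OF P]) (simp add: complexification_def)
  moreover have "Im (fst w $ j * cnj (snd w $ j)) = Im (x $ j) * (cmod (s $ j))\<^sup>2" for j
    by (simp add: w_def cmod_power2) (simp add: algebra_simps power2_eq_square)
  ultimately have "(\<Sum>j\<in>UNIV. Im (x $ j) * (cmod (s $ j))\<^sup>2) = 0" by simp
  then have "\<forall>j. Im (x $ j) * (cmod (s $ j))\<^sup>2 = 0"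
    using less_imp_le[OF x] by (subst (asm) sum_nonneg_eq_0_iff) auto
  then have "s = 0" using x by (metis less_irrefl mult_eq_0_iff norm_eq_zero vec_eq_iff zero_eq_power2 zero_index)
  then have "a = 0" by (simp add: s_def vec_eq_iff)
  with a show False by simp
qed

text \<open>The map \<open>x \<mapsto> x - D\<^sup>-\<^sup>1 (\<phi> x)\<close>, with the inverse taken in \<open>P\<close>, is a contraction of the closed \<open>\<rho>\<close>-ball of \<open>P\<close>, with
constant \<open>1/2\<close>.\<close>

lemma unique_zero_near_expanding_linear:
  fixes P :: "'a::euclidean_space set" and D :: "'a \<Rightarrow> 'b::real_normed_vector"
  assumes P: "subspace P" and D: "linear D" and surj: "D ` P = UNIV"
    and m: "0 < m" "\<And>x. x \<in> P \<Longrightarrow> m * norm x \<le> norm (D x)"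
    and \<phi>: "\<And>x y. x \<in> P \<Longrightarrow> y \<in> P \<Longrightarrow> norm x \<le> \<rho> \<Longrightarrow> norm y \<le> \<rho> \<Longrightarrow>
      norm (\<phi> x - \<phi> y - D (x - y)) \<le> m / 2 * norm (x - y)"
    and \<rho>: "0 \<le> \<rho>" "norm (\<phi> 0) \<le> m / 2 * \<rho>"
  shows "\<exists>!x. x \<in> P \<and> norm x \<le> \<rho> \<and> \<phi> x = 0"
proof -
  define I where "I r = (SOME x. x \<in> P \<and> D x = r)" for r
  have I: "I r \<in> P" "D (I r) = r" for r
  proof -
    have "r \<in> D ` P" using surj by simp
    then have "\<exists>x. x \<in> P \<and> D x = r" by auto
    from someI_ex[OF this] show "I r \<in> P" "D (I r) = r" by (simp_all add: I_def)
  qed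
  define T where "T x = x - I (\<phi> x)" for x
  have TP: "T x \<in> P" if "x \<in> P" for x using P that I by (simp add: T_def subspace_diff)
  have contr: "norm (T x - T y) \<le> 1 / 2 * norm (x - y)"
    if "x \<in> P" "y \<in> P" "norm x \<le> \<rho>" "norm y \<le> \<rho>" for x y
  proof -
    have "D (T x - T y) = - (\<phi> x - \<phi> y - D (x - y))"
      using D I by (simp add: T_def linear_diff)
    then have "norm (D (T x - T y)) \<le> m / 2 * norm (x - y)"
      using \<phi>[OF that] by (simp only: norm_minus_cancel)
    moreover have "T x - T y \<in> P" using TP that P by (simp add: subspace_diff)
    ultimately have "m * norm (T x - T y) \<le> m * (1 / 2 * norm (x - y))"
      using m(2)[of "T x - T y"] by simp
    then show ?thesis using m(1) by (rule mult_left_le_imp_le)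
  qed
  have T0: "norm (T 0) \<le> \<rho> / 2"
  proof -
    have "m * norm (T 0) \<le> norm (\<phi> 0)"
      using m(2)[of "I (\<phi> 0)"] I by (simp add: T_def)
    then have "m * norm (T 0) \<le> m * (\<rho> / 2)" using \<rho> by simp
    then show ?thesis using m(1) by (rule mult_left_le_imp_le)
  qed
  have "\<exists>!x\<in>P \<inter> cball 0 \<rho>. T x = x"
  proof (rule Banach_fix[where c = "1/2"])
    show "complete (P \<inter> cball 0 \<rho>)"
      using P by (simp add: complete_eq_closed closed_Int closed_subspace)
    show "P \<inter> cball 0 \<rho> \<noteq> {}" using subspace_0[OF P] \<rho> by force
    show "T ` (P \<inter> cball 0 \<rho>) \<subseteq> P \<inter> cball 0 \<rho>"
    proof safe
      fix x assume x: "x \<in> P" "x \<in> cball 0 \<rho>"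
      show "T x \<in> P" using TP x by simp
      have "norm (T x) \<le> norm (T x - T 0) + norm (T 0)" by (metis norm_triangle_sub add.commute)
      also have "\<dots> \<le> \<rho> / 2 + \<rho> / 2"
        using contr[of x 0] x T0 P \<rho> by (intro add_mono) (auto simp: subspace_0)
      finally show "T x \<in> cball 0 \<rho>" by simp
    qed
    show "dist (T x) (T y) \<le> 1 / 2 * dist x y" if "x \<in> P \<inter> cball 0 \<rho>" "y \<in> P \<inter> cball 0 \<rho>" for x y
      using contr[of x y] that by (simp add: dist_norm)
  qed auto
  moreover have "T x = x \<longleftrightarrow> \<phi> x = 0" if "x \<in> P" for x
  proof -
    have "I 0 = 0" using m(2)[of "I 0"] I m by (auto simp: mult_le_0_iff)
    then show ?thesis using I[of "\<phi> x"] D by (auto simp: T_def linear_0)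
  qed
  ultimately show ?thesis by (auto simp: Ex1_def)
qed

section \<open>Deformation in imaginary time\<close>

text \<open>The polynomial \<open>a t + b t\<^sup>2\<close> at the imaginary time \<open>t = i\<tau>\<close>.\<close>

definition imaginary_jet :: "real \<Rightarrow> real \<Rightarrow> real \<Rightarrow> complex" where
  "imaginary_jet a b \<tau> = \<i> * of_real (\<tau> * a) - of_real (\<tau>\<^sup>2 * b)"

lemma norm_imaginary_jet_le:
  assumes "0 \<le> \<tau>" "\<tau> \<le> 1"
  shows "norm (imaginary_jet a b \<tau>) \<le> (\<bar>a\<bar> + \<bar>b\<bar>) * \<tau>"
proof -
  have "norm (imaginary_jet a b \<tau>) \<le> \<tau> * \<bar>a\<bar> + \<tau>\<^sup>2 * \<bar>b\<bar>"
    unfolding imaginary_jet_def using assms norm_triangle_ineq4[of "\<i> * of_real (\<tau> * a)" "of_real (\<tau>\<^sup>2 * b)"]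
    by (simp add: norm_mult abs_mult norm_power)
  also have "\<tau>\<^sup>2 * \<bar>b\<bar> \<le> \<tau> * \<bar>b\<bar>"
    using assms by (intro mult_right_mono) (auto simp: power2_eq_square mult_left_le)
  finally show ?thesis by (simp add: algebra_simps)
qed

lemma norm_exp_remainder_le:
  fixes w :: complex
  assumes "norm w \<le> (K::real)"
  shows "norm (exp w - 1 - w) \<le> exp K * norm w ^ 2"
    and "norm (exp w - 1 - w - w\<^sup>2 / 2) \<le> exp K * norm w ^ 3"
proof -
  have K: "exp \<bar>Re w\<bar> \<le> exp K" using abs_Re_le_cmod[of w] assms by simp
  have "norm (exp w - (\<Sum>k\<le>1. w ^ k / fact k)) \<le> exp \<bar>Re w\<bar> * norm w ^ Suc 1 / fact 1"
    by (rule Taylor_exp)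
  also have "\<dots> \<le> exp K * norm w ^ 2"
    using K by (auto simp: numeral_2_eq_2 intro!: mult_right_mono)
  finally show "norm (exp w - 1 - w) \<le> exp K * norm w ^ 2" by (simp add: diff_diff_eq)
  have "norm (exp w - (\<Sum>k\<le>2. w ^ k / fact k)) \<le> exp \<bar>Re w\<bar> * norm w ^ Suc 2 / fact 2"
    by (rule Taylor_exp)
  also have "\<dots> \<le> exp \<bar>Re w\<bar> * norm w ^ 3"
    by (simp add: numeral_3_eq_3 numeral_2_eq_2)
  also have "\<dots> \<le> exp K * norm w ^ 3"
    using K by (intro mult_right_mono) auto
  finally show "norm (exp w - 1 - w - w\<^sup>2 / 2) \<le> exp K * norm w ^ 3"
    by (simp add: diff_diff_eq numeral_2_eq_2 add.assoc)
qed

lemma exp_imaginary_jet: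
  obtains C where "\<And>\<tau>. 0 \<le> \<tau> \<Longrightarrow> \<tau> \<le> 1 \<Longrightarrow>
    norm (exp (imaginary_jet a b \<tau>) - (1 + \<i> * of_real (\<tau> * a) - of_real (\<tau>\<^sup>2 * (b + a\<^sup>2 / 2)))) \<le> C * \<tau> ^ 3"
proof -
  define K where "K = \<bar>a\<bar> + \<bar>b\<bar>"
  show thesis
  proof (rule that[of "exp K * K ^ 3 + (\<bar>a * b\<bar> + b\<^sup>2 / 2)"])
    fix \<tau> :: real assume \<tau>: "0 \<le> \<tau>" "\<tau> \<le> 1"
    let ?w = "imaginary_jet a b \<tau>"
    have w: "norm ?w \<le> K * \<tau>" using norm_imaginary_jet_le[OF \<tau>] by (simp add: K_def)
    also have "K * \<tau> \<le> K" using \<tau> by (simp add: K_def mult_left_le)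
    finally have "norm (exp ?w - 1 - ?w - ?w\<^sup>2 / 2) \<le> exp K * norm ?w ^ 3"
      by (rule norm_exp_remainder_le)
    also have "\<dots> \<le> exp K * (K * \<tau>) ^ 3"
      by (intro mult_left_mono power_mono w) auto
    finally have 1: "norm (exp ?w - 1 - ?w - ?w\<^sup>2 / 2) \<le> exp K * K ^ 3 * \<tau> ^ 3"
      by (simp add: power_mult_distrib)
    have "norm (- \<i> * of_real (\<tau> ^ 3 * (a * b)) + of_real (\<tau> ^ 4 * b\<^sup>2 / 2))
        \<le> norm (- \<i> * of_real (\<tau> ^ 3 * (a * b))) + norm (of_real (\<tau> ^ 4 * b\<^sup>2 / 2) :: complex)"
      by (rule norm_triangle_ineq)
    also have "\<dots> = \<tau> ^ 3 * \<bar>a * b\<bar> + \<tau> ^ 4 * (b\<^sup>2 / 2)"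
      unfolding norm_mult norm_of_real using \<tau> by (simp add: abs_mult)
    also have "\<dots> \<le> \<tau> ^ 3 * \<bar>a * b\<bar> + \<tau> ^ 3 * (b\<^sup>2 / 2)"
      using \<tau> by (intro add_left_mono mult_right_mono power_decreasing) auto
    finally have 2: "norm (- \<i> * of_real (\<tau> ^ 3 * (a * b)) + of_real (\<tau> ^ 4 * b\<^sup>2 / 2) :: complex)
        \<le> (\<bar>a * b\<bar> + b\<^sup>2 / 2) * \<tau> ^ 3" by (simp add: algebra_simps)
    have sq: "?w\<^sup>2 / 2 = - of_real (\<tau>\<^sup>2 * (a\<^sup>2 / 2)) + (- \<i> * of_real (\<tau> ^ 3 * (a * b)) + of_real (\<tau> ^ 4 * b\<^sup>2 / 2))"
      by (simp add: imaginary_jet_def complex_eq_iff power2_eq_square power3_eq_cube power4_eq_xxxx field_simps)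
    have "exp ?w - (1 + \<i> * of_real (\<tau> * a) - of_real (\<tau>\<^sup>2 * (b + a\<^sup>2 / 2))) =
        (exp ?w - 1 - ?w - ?w\<^sup>2 / 2) + (- \<i> * of_real (\<tau> ^ 3 * (a * b)) + of_real (\<tau> ^ 4 * b\<^sup>2 / 2))"
      unfolding sq by (simp add: imaginary_jet_def algebra_simps)
    then show "norm (exp ?w - (1 + \<i> * of_real (\<tau> * a) - of_real (\<tau>\<^sup>2 * (b + a\<^sup>2 / 2))))
        \<le> (exp K * K ^ 3 + (\<bar>a * b\<bar> + b\<^sup>2 / 2)) * \<tau> ^ 3"
      using norm_triangle_mono[OF 1 2] by (simp only: distrib_right)
  qed
qed

lemma exp_near_imaginary_jet:
  obtains C where "1 \<le> C" "\<And>\<tau> \<epsilon> (h :: complex). 0 \<le> \<tau> \<Longrightarrow> \<tau> \<le> 1 \<Longrightarrow> 0 \<le> \<epsilon> \<Longrightarrow> \<epsilon> \<le> 1 \<Longrightarrow> norm h \<le> \<epsilon> * \<tau> \<Longrightarrow>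
    norm (exp (imaginary_jet a b \<tau> + h) - (1 + \<i> * of_real (\<tau> * a))) \<le> C * (\<tau> + \<epsilon>) * \<tau>"
proof -
  define K where "K = \<bar>a\<bar> + \<bar>b\<bar> + 1"
  have K: "1 \<le> K" by (simp add: K_def)
  show thesis
  proof (rule that[of "exp K * K\<^sup>2 + \<bar>b\<bar> + 1"])
    show "1 \<le> exp K * K\<^sup>2 + \<bar>b\<bar> + 1" by simp
    fix \<tau> \<epsilon> :: real and h :: complex assume \<tau>: "0 \<le> \<tau>" "\<tau> \<le> 1" and \<epsilon>: "0 \<le> \<epsilon>" "\<epsilon> \<le> 1" and h: "norm h \<le> \<epsilon> * \<tau>"
    let ?w = "imaginary_jet a b \<tau> + h"
    have "norm h \<le> 1 * \<tau>" using h \<epsilon> \<tau> by (intro order_trans[OF h] mult_right_mono) auto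
    then have w: "norm ?w \<le> K * \<tau>"
      using norm_imaginary_jet_le[OF \<tau>, of a b] norm_triangle_ineq[of "imaginary_jet a b \<tau>" h]
      by (simp add: K_def algebra_simps)
    also have "K * \<tau> \<le> K" using \<tau> K by (simp add: mult_left_le)
    finally have "norm (exp ?w - 1 - ?w) \<le> exp K * norm ?w ^ 2"
      by (rule norm_exp_remainder_le)
    also have "\<dots> \<le> exp K * (K * \<tau>) ^ 2"
      by (intro mult_left_mono power_mono w) auto
    finally have 1: "norm (exp ?w - 1 - ?w) \<le> exp K * K\<^sup>2 * \<tau>\<^sup>2"
      by (simp add: power_mult_distrib)
    have 2: "norm (h - of_real (\<tau>\<^sup>2 * b)) \<le> \<epsilon> * \<tau> + \<bar>b\<bar> * \<tau>\<^sup>2"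
      using norm_triangle_ineq4[of h "of_real (\<tau>\<^sup>2 * b)"] h
      by (simp add: norm_mult norm_power algebra_simps)
    have "exp ?w - (1 + \<i> * of_real (\<tau> * a)) = (exp ?w - 1 - ?w) + (h - of_real (\<tau>\<^sup>2 * b))"
      by (simp add: imaginary_jet_def)
    then have "norm (exp ?w - (1 + \<i> * of_real (\<tau> * a))) \<le> exp K * K\<^sup>2 * \<tau>\<^sup>2 + (\<epsilon> * \<tau> + \<bar>b\<bar> * \<tau>\<^sup>2)"
      using norm_triangle_mono[OF 1 2] by (simp only:)
    also have "\<dots> \<le> (exp K * K\<^sup>2 + \<bar>b\<bar> + 1) * \<tau>\<^sup>2 + (exp K * K\<^sup>2 + \<bar>b\<bar> + 1) * (\<epsilon> * \<tau>)"
    proof -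
      have "1 * (\<epsilon> * \<tau>) \<le> (exp K * K\<^sup>2 + \<bar>b\<bar> + 1) * (\<epsilon> * \<tau>)"
        using \<epsilon> \<tau> by (intro mult_right_mono) auto
      then show ?thesis using zero_le_power2[of \<tau>] by (simp add: distrib_right)
    qed
    also have "\<dots> = (exp K * K\<^sup>2 + \<bar>b\<bar> + 1) * (\<tau> + \<epsilon>) * \<tau>"
      by (simp add: algebra_simps power2_eq_square)
    finally show "norm (exp ?w - (1 + \<i> * of_real (\<tau> * a))) \<le> (exp K * K\<^sup>2 + \<bar>b\<bar> + 1) * (\<tau> + \<epsilon>) * \<tau>" .
  qed
qed

lemma norm_vec_le_card:
  fixes x :: "('a::real_normed_vector) ^ 'n::finite"
  assumes "\<And>j. norm (x $ j) \<le> B"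
  shows "norm x \<le> real CARD('n) * B"
proof -
  have "norm x \<le> (\<Sum>j\<in>UNIV. norm (x $ j))"
    unfolding norm_vec_def by (rule L2_set_le_sum) simp
  also have "\<dots> \<le> real CARD('n) * B"
    using assms by (intro sum_bounded_above)
  finally show ?thesis .
qed

lemma finite_bounds:
  fixes P :: "'n::finite \<Rightarrow> real \<Rightarrow> bool"
  assumes "\<And>j. \<exists>C. P j C" and mono: "\<And>j C C'. P j C \<Longrightarrow> C \<le> C' \<Longrightarrow> P j C'"
  obtains C where "1 \<le> C" "\<And>j. P j C"
proof -
  from assms(1) obtain f where f: "\<And>j. P j (f j)" by metis
  show thesis
  proof (rule that[of "Max (insert 1 (range f))"])
    show "P j (Max (insert 1 (range f)))" for j by (rule mono[OF f], rule Max_ge) auto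
  qed simp
qed


definition imaginary_jets ::
  "(real ^ 'n) \<times> (real ^ 'n) \<Rightarrow> (real ^ 'n) \<times> (real ^ 'n) \<Rightarrow> real \<Rightarrow> (complex ^ 'n::finite) \<times> (complex ^ 'n)"
  where "imaginary_jets a b \<tau> =
    (\<chi> j. imaginary_jet (fst a $ j) (fst b $ j) \<tau>, \<chi> j. imaginary_jet (snd a $ j) (snd b $ j) \<tau>)"

text \<open>It vanishes exactly when \<open>z e\<^sup>p\<close> and \<open>(1 - z) e\<^sup>q\<close> have the form \<open>x\<close> and \<open>1 - x\<close> in each tetrahedron.\<close>

definition closing_defect :: "real ^ 'n \<Rightarrow> (complex ^ 'n) \<times> (complex ^ 'n) \<Rightarrow> complex ^ 'n::finite" where
  "closing_defect z w =
    (\<chi> j. of_real (z $ j) * exp (fst w $ j) + of_real (1 - z $ j) * exp (snd w $ j) - 1)"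

lemma continuous_on_imaginary_jets: "continuous_on S (imaginary_jets a b)"
  unfolding imaginary_jets_def imaginary_jet_def
  by (intro continuous_intros)

lemma continuous_on_closing_defect [continuous_intros]:
  "continuous_on S f \<Longrightarrow> continuous_on S (\<lambda>x. closing_defect z (f x))"
  unfolding closing_defect_def
  by (intro continuous_intros)

text \<open>The hypotheses say that the Taylor coefficients of order one and two of the closing equation along
\<open>t \<mapsto> a t + b t\<^sup>2\<close> vanish; this concerns polynomials in \<open>t\<close>, so it holds at imaginary \<open>t\<close> too.\<close>

lemma closing_defect_imaginary_jets:
  fixes z :: "real ^ 'n::finite" and a b
  assumes first: "\<And>j. z $ j * fst a $ j + (1 - z $ j) * snd a $ j = 0"
    and second: "\<And>j. z $ j * (fst b $ j + (fst a $ j)\<^sup>2 / 2) + (1 - z $ j) * (snd b $ j + (snd a $ j)\<^sup>2 / 2) = 0"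
  obtains C where "1 \<le> C" "\<And>\<tau>. 0 \<le> \<tau> \<Longrightarrow> \<tau> \<le> 1 \<Longrightarrow>
    norm (closing_defect z (imaginary_jets a b \<tau>)) \<le> C * \<tau> ^ 3"
proof -
  have "\<exists>C. \<forall>\<tau>. 0 \<le> \<tau> \<longrightarrow> \<tau> \<le> 1 \<longrightarrow>
      norm (closing_defect z (imaginary_jets a b \<tau>) $ j) \<le> C * \<tau> ^ 3" for j
  proof -
    obtain C where C: "\<And>\<tau>. 0 \<le> \<tau> \<Longrightarrow> \<tau> \<le> 1 \<Longrightarrow> norm (exp (imaginary_jet (fst a $ j) (fst b $ j) \<tau>) -
        (1 + \<i> * of_real (\<tau> * fst a $ j) - of_real (\<tau>\<^sup>2 * (fst b $ j + (fst a $ j)\<^sup>2 / 2)))) \<le> C * \<tau> ^ 3"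
      using exp_imaginary_jet by blast
    obtain C' where C': "\<And>\<tau>. 0 \<le> \<tau> \<Longrightarrow> \<tau> \<le> 1 \<Longrightarrow> norm (exp (imaginary_jet (snd a $ j) (snd b $ j) \<tau>) -
        (1 + \<i> * of_real (\<tau> * snd a $ j) - of_real (\<tau>\<^sup>2 * (snd b $ j + (snd a $ j)\<^sup>2 / 2)))) \<le> C' * \<tau> ^ 3"
      using exp_imaginary_jet by blast
    show ?thesis
    proof (intro exI allI impI)
      fix \<tau> :: real assume \<tau>: "0 \<le> \<tau>" "\<tau> \<le> 1"
      define r where "r = exp (imaginary_jet (fst a $ j) (fst b $ j) \<tau>) -
        (1 + \<i> * of_real (\<tau> * fst a $ j) - of_real (\<tau>\<^sup>2 * (fst b $ j + (fst a $ j)\<^sup>2 / 2)))"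
      define r' where "r' = exp (imaginary_jet (snd a $ j) (snd b $ j) \<tau>) -
        (1 + \<i> * of_real (\<tau> * snd a $ j) - of_real (\<tau>\<^sup>2 * (snd b $ j + (snd a $ j)\<^sup>2 / 2)))"
      have "closing_defect z (imaginary_jets a b \<tau>) $ j = of_real (z $ j) * r + of_real (1 - z $ j) * r'
          + \<i> * of_real \<tau> * of_real (z $ j * fst a $ j + (1 - z $ j) * snd a $ j)
          - of_real (\<tau>\<^sup>2) * of_real (z $ j * (fst b $ j + (fst a $ j)\<^sup>2 / 2) + (1 - z $ j) * (snd b $ j + (snd a $ j)\<^sup>2 / 2))"
        by (simp add: closing_defect_def imaginary_jets_def r_def r'_def algebra_simps add_divide_distrib diff_divide_distrib)
      then have "closing_defect z (imaginary_jets a b \<tau>) $ j = of_real (z $ j) * r + of_real (1 - z $ j) * r'"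
        unfolding first second by simp
      then have "norm (closing_defect z (imaginary_jets a b \<tau>) $ j)
          \<le> norm (of_real (z $ j) * r) + norm (of_real (1 - z $ j) * r')"
        by (simp only: norm_triangle_ineq)
      also have "\<dots> \<le> \<bar>z $ j\<bar> * (C * \<tau> ^ 3) + \<bar>1 - z $ j\<bar> * (C' * \<tau> ^ 3)"
        unfolding norm_mult norm_of_real r_def r'_def
        by (intro add_mono mult_left_mono C C' \<tau>) auto
      finally show "norm (closing_defect z (imaginary_jets a b \<tau>) $ j) \<le> (\<bar>z $ j\<bar> * C + \<bar>1 - z $ j\<bar> * C') * \<tau> ^ 3"
        by (simp add: algebra_simps)
    qed
  qed
  moreover have "\<forall>\<tau>. 0 \<le> \<tau> \<longrightarrow> \<tau> \<le> 1 \<longrightarrow> N \<tau> \<le> C' * \<tau> ^ 3"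
    if "\<forall>\<tau>. 0 \<le> \<tau> \<longrightarrow> \<tau> \<le> 1 \<longrightarrow> N \<tau> \<le> C * \<tau> ^ 3" "C \<le> C'" for N :: "real \<Rightarrow> real" and C C'
    using that by (meson mult_right_mono order_trans zero_le_power)
  ultimately obtain C where C: "1 \<le> C" "\<And>j. \<forall>\<tau>. 0 \<le> \<tau> \<longrightarrow> \<tau> \<le> 1 \<longrightarrow>
      norm (closing_defect z (imaginary_jets a b \<tau>) $ j) \<le> C * \<tau> ^ 3"
    by (rule finite_bounds[where P = "\<lambda>j C. \<forall>\<tau>. 0 \<le> \<tau> \<longrightarrow> \<tau> \<le> 1 \<longrightarrow>
      norm (closing_defect z (imaginary_jets a b \<tau>) $ j) \<le> C * \<tau> ^ 3"]) blast+
  show thesis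
  proof (rule that[of "real CARD('n) * C"])
    have "1 * 1 \<le> real CARD('n) * C" using C(1) by (intro mult_mono) (auto simp: Suc_leI)
    then show "1 \<le> real CARD('n) * C" by simp
    show "norm (closing_defect z (imaginary_jets a b \<tau>)) \<le> real CARD('n) * C * \<tau> ^ 3"
      if "0 \<le> \<tau>" "\<tau> \<le> 1" for \<tau>
      using C(2) that norm_vec_le_card[of "closing_defect z (imaginary_jets a b \<tau>)" "C * \<tau> ^ 3"]
      by (simp add: mult.assoc)
  qed
qed

lemma exp_imaginary_jets_bound:
  fixes z v :: "real ^ 'n::finite"
  assumes first: "\<And>j. z $ j * a $ j = v $ j"
  obtains C where "1 \<le> C" "\<And>\<tau> \<epsilon> (h :: complex) j. 0 \<le> \<tau> \<Longrightarrow> \<tau> \<le> 1 \<Longrightarrow> 0 \<le> \<epsilon> \<Longrightarrow> \<epsilon> \<le> 1 \<Longrightarrow> norm h \<le> \<epsilon> * \<tau> \<Longrightarrow>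
    norm (of_real (z $ j) * exp (imaginary_jet (a $ j) (b $ j) \<tau> + h) - (of_real (z $ j) + \<i> * of_real (\<tau> * v $ j)))
      \<le> C * (\<tau> + \<epsilon>) * \<tau>"
proof -
  define Q where "Q j C \<longleftrightarrow> (\<forall>\<tau> \<epsilon> (h :: complex). 0 \<le> \<tau> \<longrightarrow> \<tau> \<le> 1 \<longrightarrow> 0 \<le> \<epsilon> \<longrightarrow> \<epsilon> \<le> 1 \<longrightarrow> norm h \<le> \<epsilon> * \<tau> \<longrightarrow>
    norm (of_real (z $ j) * exp (imaginary_jet (a $ j) (b $ j) \<tau> + h) - (of_real (z $ j) + \<i> * of_real (\<tau> * v $ j)))
      \<le> C * (\<tau> + \<epsilon>) * \<tau>)" for j C
  have "\<exists>C. Q j C" for j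
  proof -
    obtain C where C: "\<And>\<tau> \<epsilon> (h :: complex). 0 \<le> \<tau> \<Longrightarrow> \<tau> \<le> 1 \<Longrightarrow> 0 \<le> \<epsilon> \<Longrightarrow> \<epsilon> \<le> 1 \<Longrightarrow> norm h \<le> \<epsilon> * \<tau> \<Longrightarrow>
      norm (exp (imaginary_jet (a $ j) (b $ j) \<tau> + h) - (1 + \<i> * of_real (\<tau> * a $ j))) \<le> C * (\<tau> + \<epsilon>) * \<tau>"
      using exp_near_imaginary_jet[of "a $ j" "b $ j"] by metis
    have "Q j (\<bar>z $ j\<bar> * C)"
      unfolding Q_def
    proof (intro allI impI)
      fix \<tau> \<epsilon> :: real and h :: complex
      assume H: "0 \<le> \<tau>" "\<tau> \<le> 1" "0 \<le> \<epsilon>" "\<epsilon> \<le> 1" "norm h \<le> \<epsilon> * \<tau>"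
      have "of_real (z $ j) * exp (imaginary_jet (a $ j) (b $ j) \<tau> + h) - (of_real (z $ j) + \<i> * of_real (\<tau> * v $ j))
        = of_real (z $ j) * (exp (imaginary_jet (a $ j) (b $ j) \<tau> + h) - (1 + \<i> * of_real (\<tau> * a $ j)))"
        by (simp add: first[symmetric] algebra_simps)
      then show "norm (of_real (z $ j) * exp (imaginary_jet (a $ j) (b $ j) \<tau> + h) - (of_real (z $ j) + \<i> * of_real (\<tau> * v $ j)))
        \<le> \<bar>z $ j\<bar> * C * (\<tau> + \<epsilon>) * \<tau>"
        using mult_left_mono[OF C[OF H], of "\<bar>z $ j\<bar>"] by (simp add: norm_mult mult.assoc)
    qed
    then show ?thesis ..
  qed
  moreover have "Q j C'" if Q: "Q j C" and CC': "C \<le> C'" for j C C'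
    unfolding Q_def
  proof (intro allI impI)
    fix \<tau> \<epsilon> :: real and h :: complex
    assume H: "0 \<le> \<tau>" "\<tau> \<le> 1" "0 \<le> \<epsilon>" "\<epsilon> \<le> 1" "norm h \<le> \<epsilon> * \<tau>"
    have "C * (\<tau> + \<epsilon>) * \<tau> \<le> C' * (\<tau> + \<epsilon>) * \<tau>"
      using H CC' by (intro mult_right_mono) auto
    then show "norm (of_real (z $ j) * exp (imaginary_jet (a $ j) (b $ j) \<tau> + h) - (of_real (z $ j) + \<i> * of_real (\<tau> * v $ j)))
      \<le> C' * (\<tau> + \<epsilon>) * \<tau>"
      using Q H unfolding Q_def by (blast intro: order_trans)
  qed
  ultimately obtain C where C: "1 \<le> C" "\<And>j. Q j C"
    by (rule finite_bounds[of Q]) blast+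
  show thesis
    by (rule that[OF C(1)]) (use C(2) in \<open>simp add: Q_def\<close>)
qed

text \<open>The correction \<open>\<xi> \<tau>\<close> is looked for in the ball of radius \<open>\<epsilon>\<tau>\<close> of the complexification of \<open>P\<close>.  There the
differential of the closing defect differs from \<open>shape_differential (z + i\<tau>v)\<close> by at most a multiple of
\<open>(\<tau> + \<epsilon>) \<tau>\<close>, which for small \<open>\<epsilon>\<close> and \<open>\<tau>\<close> is below half of the lower bound \<open>\<kappa>\<tau>\<close> of that map, and the
defect \<open>O(\<tau>\<^sup>3)\<close> at the centre is below \<open>\<kappa>\<epsilon>\<tau>\<^sup>2 / 2\<close>.  So there is a unique zero.  Uniqueness makes the graph of
\<open>\<xi>\<close> closed, and a function with closed graph and values in a compact set is continuous.\<close>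

lemma lagrangian_deformation:
  fixes z v :: "real ^ 'n::finite" and P :: "((real ^ 'n) \<times> (real ^ 'n)) set"
  assumes P: "lagrangian P" and v: "\<And>j. 0 < v $ j"
    and first: "\<And>j. z $ j * fst a $ j = v $ j" "\<And>j. (1 - z $ j) * snd a $ j = - v $ j"
    and second: "\<And>j. z $ j * (fst b $ j + (fst a $ j)\<^sup>2 / 2) + (1 - z $ j) * (snd b $ j + (snd a $ j)\<^sup>2 / 2) = 0"
  obtains \<tau>0 \<xi> where "0 < \<tau>0" "continuous_on {0..\<tau>0} \<xi>" "\<xi> 0 = 0"
    "\<And>\<tau>. 0 \<le> \<tau> \<Longrightarrow> \<tau> \<le> \<tau>0 \<Longrightarrow> \<xi> \<tau> \<in> complexification P"
    "\<And>\<tau>. 0 \<le> \<tau> \<Longrightarrow> \<tau> \<le> \<tau>0 \<Longrightarrow> closing_defect z (imaginary_jets a b \<tau> + \<xi> \<tau>) = 0"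
    "\<And>\<tau> j. 0 < \<tau> \<Longrightarrow> \<tau> \<le> \<tau>0 \<Longrightarrow> 0 < Im (of_real (z $ j) * exp (fst (imaginary_jets a b \<tau> + \<xi> \<tau>) $ j))"
proof -
  have sum0: "z $ j * fst a $ j + (1 - z $ j) * snd a $ j = 0" for j by (simp add: first)
  have first2: "(1 - z) $ j * snd a $ j = (- v) $ j" for j by (simp add: first)
  obtain C1 where C1: "1 \<le> C1" "\<And>\<tau>. 0 \<le> \<tau> \<Longrightarrow> \<tau> \<le> 1 \<Longrightarrow> norm (closing_defect z (imaginary_jets a b \<tau>)) \<le> C1 * \<tau> ^ 3"
    by (rule closing_defect_imaginary_jets[OF sum0 second]) blast
  obtain C2 where C2: "1 \<le> C2" "\<And>\<tau> \<epsilon> (h :: complex) j. 0 \<le> \<tau> \<Longrightarrow> \<tau> \<le> 1 \<Longrightarrow> 0 \<le> \<epsilon> \<Longrightarrow> \<epsilon> \<le> 1 \<Longrightarrow> norm h \<le> \<epsilon> * \<tau> \<Longrightarrow>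
    norm (of_real (z $ j) * exp (imaginary_jet (fst a $ j) (fst b $ j) \<tau> + h) - (of_real (z $ j) + \<i> * of_real (\<tau> * v $ j)))
      \<le> C2 * (\<tau> + \<epsilon>) * \<tau>"
    by (rule exp_imaginary_jets_bound[OF first(1)]) blast
  obtain C3 where C3: "1 \<le> C3" "\<And>\<tau> \<epsilon> (h :: complex) j. 0 \<le> \<tau> \<Longrightarrow> \<tau> \<le> 1 \<Longrightarrow> 0 \<le> \<epsilon> \<Longrightarrow> \<epsilon> \<le> 1 \<Longrightarrow> norm h \<le> \<epsilon> * \<tau> \<Longrightarrow>
    norm (of_real ((1 - z) $ j) * exp (imaginary_jet (snd a $ j) (snd b $ j) \<tau> + h) - (of_real ((1 - z) $ j) + \<i> * of_real (\<tau> * (- v) $ j)))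
      \<le> C3 * (\<tau> + \<epsilon>) * \<tau>"
    by (rule exp_imaginary_jets_bound[OF first2]) blast
  define C where "C = max C2 C3"
  define n where "n = real CARD('n)"
  define v0 where "v0 = Min (insert 1 (range (($) v)))"
  obtain B where B: "1 \<le> B" "\<And>j. \<bar>z $ j\<bar> + v $ j \<le> B"
    by (rule finite_bounds[of "\<lambda>j C. \<bar>z $ j\<bar> + v $ j \<le> C"]) auto
  \<comment> \<open>\<open>\<kappa> * \<tau>\<close> will bound the differential at \<open>z + i\<tau>v\<close> below, as \<open>Im x\<^sub>j \<ge> v0 * \<tau>\<close> and \<open>\<bar>x\<^sub>j\<bar> \<le> B\<close> there.\<close>
  define \<kappa> where "\<kappa> = v0 / (2 * B + 3)"
  \<comment> \<open>Over \<open>n\<close> coordinates, each with two terms of size \<open>C (\<tau> + \<epsilon>) \<tau>\<close>, the choice of \<open>\<epsilon>\<close> and \<open>\<tau>0\<close>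
    keeps the error below \<open>\<kappa> \<tau> / 2\<close>; the last bound on \<open>\<tau>0\<close> controls the defect at the centre.\<close>
  define \<epsilon> where "\<epsilon> = min 1 (\<kappa> / (8 * n * C))"
  define \<tau>0 where "\<tau>0 = min 1 (min (\<kappa> / (8 * n * C)) (\<kappa> * \<epsilon> / (2 * C1)))"
  have n: "1 \<le> n" by (simp add: n_def Suc_leI)
  have v0: "0 < v0" "v0 \<le> 1" "v0 \<le> v $ j" for j
    using v unfolding v0_def by (auto intro: Min_le simp del: Min_insert)
  have C: "1 \<le> C" using C2 by (simp add: C_def)
  have \<kappa>: "0 < \<kappa>" "\<kappa> < v0" using v0 B by (auto simp: \<kappa>_def divide_less_eq)
  have \<epsilon>: "0 < \<epsilon>" "\<epsilon> \<le> 1" "8 * n * C * \<epsilon> \<le> \<kappa>" using n C \<kappa> by (auto simp: \<epsilon>_def min_def field_simps)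
  have "\<tau>0 \<le> \<kappa> / (8 * n * C)" "\<tau>0 \<le> \<kappa> * \<epsilon> / (2 * C1)" unfolding \<tau>0_def by simp_all
  then have \<tau>0: "0 < \<tau>0" "\<tau>0 \<le> 1" "8 * n * C * \<tau>0 \<le> \<kappa>" "2 * C1 * \<tau>0 \<le> \<kappa> * \<epsilon>"
    using n C \<kappa> \<epsilon> C1(1) by (simp_all add: \<tau>0_def pos_le_divide_eq mult.commute)
  have E: "C * (\<tau> + \<epsilon>) * \<tau> \<le> \<kappa> / (4 * n) * \<tau>" if "0 \<le> \<tau>" "\<tau> \<le> \<tau>0" for \<tau>
  proof -
    have "8 * n * C * \<tau> \<le> 8 * n * C * \<tau>0" using that n C by (intro mult_left_mono) auto
    then have "C * (\<tau> + \<epsilon>) \<le> \<kappa> / (4 * n)" using \<tau>0(3) \<epsilon>(3) n by (simp add: field_simps)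
    then show ?thesis using that by (intro mult_right_mono)
  qed
  have close1: "norm (of_real (z $ j) * exp (fst (imaginary_jets a b \<tau>) $ j + h) - (of_real (z $ j) + \<i> * of_real (\<tau> * v $ j)))
      \<le> \<kappa> / (4 * n) * \<tau>"
    and close2: "norm (of_real (1 - z $ j) * exp (snd (imaginary_jets a b \<tau>) $ j + h) - (1 - (of_real (z $ j) + \<i> * of_real (\<tau> * v $ j))))
      \<le> \<kappa> / (4 * n) * \<tau>"
    if \<tau>: "0 \<le> \<tau>" "\<tau> \<le> \<tau>0" and h: "norm h \<le> \<epsilon> * \<tau>" for \<tau> h j
  proof -
    have \<tau>1: "\<tau> \<le> 1" and \<epsilon>0: "0 \<le> \<epsilon>" using \<tau> \<tau>0 \<epsilon> by auto
    have mono: "C2 * (\<tau> + \<epsilon>) * \<tau> \<le> C * (\<tau> + \<epsilon>) * \<tau>" "C3 * (\<tau> + \<epsilon>) * \<tau> \<le> C * (\<tau> + \<epsilon>) * \<tau>"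
      using \<tau> \<epsilon> by (auto simp: C_def intro!: mult_right_mono)
    show "norm (of_real (z $ j) * exp (fst (imaginary_jets a b \<tau>) $ j + h) - (of_real (z $ j) + \<i> * of_real (\<tau> * v $ j)))
      \<le> \<kappa> / (4 * n) * \<tau>"
      using order_trans[OF C2(2)[OF \<tau>(1) \<tau>1 \<epsilon>0 \<epsilon>(2) h] order_trans[OF mono(1) E[OF \<tau>]], of j]
      by (simp add: imaginary_jets_def)
    show "norm (of_real (1 - z $ j) * exp (snd (imaginary_jets a b \<tau>) $ j + h) - (1 - (of_real (z $ j) + \<i> * of_real (\<tau> * v $ j))))
      \<le> \<kappa> / (4 * n) * \<tau>"
      using order_trans[OF C3(2)[OF \<tau>(1) \<tau>1 \<epsilon>0 \<epsilon>(2) h] order_trans[OF mono(2) E[OF \<tau>]], of j]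
      by (simp add: imaginary_jets_def algebra_simps)
  qed
  define \<phi> where "\<phi> \<tau> u = closing_defect z (imaginary_jets a b \<tau> + u)" for \<tau> u
  define x where "x \<tau> = (\<chi> j. complex_of_real (z $ j) + \<i> * of_real (\<tau> * v $ j))" for \<tau>
  have zero: "\<exists>!u. u \<in> complexification P \<and> norm u \<le> \<epsilon> * \<tau> \<and> \<phi> \<tau> u = 0"
    if \<tau>: "0 \<le> \<tau>" "\<tau> \<le> \<tau>0" for \<tau>
  proof (cases "\<tau> = 0")
    case True
    have "closing_defect z (imaginary_jets a b 0) = 0"
      by (simp add: closing_defect_def imaginary_jets_def imaginary_jet_def vec_eq_iff)
    then show ?thesis using True subspace_0[OF subspace_complexification[OF subspace_lagrangian[OF P]]]
      by (intro ex1I[of _ 0]) (simp_all add: \<phi>_def)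
  next
    case False
    with \<tau> have \<tau>: "0 < \<tau>" "\<tau> \<le> \<tau>0" "\<tau> \<le> 1" using \<tau>0 by auto
    show ?thesis
    proof (rule unique_zero_near_expanding_linear)
      show "subspace (complexification P)" by (intro subspace_complexification subspace_lagrangian P)
      show "linear (shape_differential (x \<tau>))" by (rule linear_shape_differential)
      show "shape_differential (x \<tau>) ` complexification P = UNIV"
        using v \<tau> by (intro shape_differential_surj P) (simp add: x_def)
      show "0 < \<kappa> * \<tau>" using \<kappa> \<tau> by simp
      show "0 \<le> \<epsilon> * \<tau>" using \<epsilon> \<tau> by simp
      show "\<kappa> * \<tau> * norm u \<le> norm (shape_differential (x \<tau>) u)" if u: "u \<in> complexification P" for u
      proof -
        have "v0 * \<tau> * norm u \<le> (2 * B + 3) * norm (shape_differential (x \<tau>) u)"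
        proof (rule shape_differential_bounded_below[OF P u])
          show "0 < v0 * \<tau>" "v0 * \<tau> \<le> 1" using v0 \<tau> by (auto intro: mult_le_one)
          show "v0 * \<tau> \<le> Im (x \<tau> $ j)" for j
            using v0(3)[of j] \<tau> by (simp add: x_def mult.commute mult_right_mono)
          show "cmod (x \<tau> $ j) \<le> B" for j
          proof -
            have "cmod (x \<tau> $ j) \<le> \<bar>z $ j\<bar> + \<tau> * v $ j"
              using norm_triangle_ineq[of "complex_of_real (z $ j)" "\<i> * of_real (\<tau> * v $ j)"] \<tau> v[of j]
              by (simp add: x_def norm_mult abs_mult)
            also have "\<tau> * v $ j \<le> v $ j" using \<tau> v[of j] by (simp add: mult_left_le_one_le)
            finally show ?thesis using B(2)[of j] by simp
          qed
        qed (use B in auto)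
        then show ?thesis using B by (simp add: \<kappa>_def field_simps)
      qed
      show "norm (\<phi> \<tau> u - \<phi> \<tau> w - shape_differential (x \<tau>) (u - w)) \<le> \<kappa> * \<tau> / 2 * norm (u - w)"
        if "norm u \<le> \<epsilon> * \<tau>" "norm w \<le> \<epsilon> * \<tau>" for u w
      proof -
        let ?E = "\<kappa> / (4 * n) * \<tau>"
        have nth: "norm (fst u $ j) \<le> norm u" "norm (snd u $ j) \<le> norm u"
          for u :: "(complex ^ 'n) \<times> (complex ^ 'n)" and j
          using Finite_Cartesian_Product.norm_nth_le[of "fst u" j] Finite_Cartesian_Product.norm_nth_le[of "snd u" j] norm_fst_le[of "fst u" "snd u"] norm_snd_le[of "snd u" "fst u"]
          by auto
        have "norm ((\<phi> \<tau> u - \<phi> \<tau> w - shape_differential (x \<tau>) (u - w)) $ j) \<le> 2 * ?E * norm (u - w)" for j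
        proof -
          define f where "f h = of_real (z $ j) * exp (fst (imaginary_jets a b \<tau>) $ j + h) - x \<tau> $ j * h" for h
          define g where "g h = of_real (1 - z $ j) * exp (snd (imaginary_jets a b \<tau>) $ j + h) - (1 - x \<tau> $ j) * h" for h
          have f: "norm (f (fst u $ j) - f (fst w $ j)) \<le> ?E * norm (fst u $ j - fst w $ j)"
          proof (rule field_differentiable_bound[of "cball 0 (\<epsilon> * \<tau>)"])
            show "(f has_field_derivative of_real (z $ j) * exp (fst (imaginary_jets a b \<tau>) $ j + h) - x \<tau> $ j)
                (at h within cball 0 (\<epsilon> * \<tau>))" for h
              unfolding f_def by (auto intro!: derivative_eq_intros)
            show "norm (of_real (z $ j) * exp (fst (imaginary_jets a b \<tau>) $ j + h) - x \<tau> $ j) \<le> ?E"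
              if "h \<in> cball 0 (\<epsilon> * \<tau>)" for h
              using close1[of \<tau> h j] \<tau> that by (simp add: x_def)
          qed (use order_trans[OF nth(1) that(1)] order_trans[OF nth(1) that(2)] in auto)
          have g: "norm (g (snd u $ j) - g (snd w $ j)) \<le> ?E * norm (snd u $ j - snd w $ j)"
          proof (rule field_differentiable_bound[of "cball 0 (\<epsilon> * \<tau>)"])
            show "(g has_field_derivative of_real (1 - z $ j) * exp (snd (imaginary_jets a b \<tau>) $ j + h) - (1 - x \<tau> $ j))
                (at h within cball 0 (\<epsilon> * \<tau>))" for h
              unfolding g_def by (auto intro!: derivative_eq_intros)
            show "norm (of_real (1 - z $ j) * exp (snd (imaginary_jets a b \<tau>) $ j + h) - (1 - x \<tau> $ j)) \<le> ?E"
              if "h \<in> cball 0 (\<epsilon> * \<tau>)" for h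
              using close2[of \<tau> h j] \<tau> that by (simp add: x_def)
          qed (use order_trans[OF nth(2) that(1)] order_trans[OF nth(2) that(2)] in auto)
          have "(\<phi> \<tau> u - \<phi> \<tau> w - shape_differential (x \<tau>) (u - w)) $ j
              = (f (fst u $ j) - f (fst w $ j)) + (g (snd u $ j) - g (snd w $ j))"
            by (simp add: \<phi>_def closing_defect_def shape_differential_def f_def g_def algebra_simps)
          then have "norm ((\<phi> \<tau> u - \<phi> \<tau> w - shape_differential (x \<tau>) (u - w)) $ j)
              \<le> ?E * norm (fst u $ j - fst w $ j) + ?E * norm (snd u $ j - snd w $ j)"
            using norm_triangle_mono[OF f g] by (simp only:)
          also have "\<dots> \<le> ?E * norm (u - w) + ?E * norm (u - w)"
            using nth[of "u - w" j] \<kappa> \<tau> n by (intro add_mono mult_left_mono) auto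
          finally show ?thesis by simp
        qed
        then have "norm (\<phi> \<tau> u - \<phi> \<tau> w - shape_differential (x \<tau>) (u - w)) \<le> n * (2 * ?E * norm (u - w))"
          unfolding n_def by (rule norm_vec_le_card)
        then show ?thesis using n by simp
      qed
      show "norm (\<phi> \<tau> 0) \<le> \<kappa> * \<tau> / 2 * (\<epsilon> * \<tau>)"
      proof -
        have "norm (\<phi> \<tau> 0) \<le> C1 * \<tau> ^ 3" using C1(2)[of \<tau>] \<tau> by (simp add: \<phi>_def)
        also have "\<dots> = C1 * \<tau> * \<tau>\<^sup>2" by (simp add: power2_eq_square power3_eq_cube)
        also have "\<dots> \<le> (\<kappa> * \<epsilon> / 2) * \<tau>\<^sup>2"
        proof (rule mult_right_mono)
          have "C1 * \<tau> \<le> C1 * \<tau>0" using \<tau> C1 by (intro mult_left_mono) auto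
          then show "C1 * \<tau> \<le> \<kappa> * \<epsilon> / 2" using \<tau>0(4) by simp
        qed simp
        finally show ?thesis by (simp add: power2_eq_square algebra_simps)
      qed
    qed
  qed
  define \<xi> where "\<xi> \<tau> = (THE u. u \<in> complexification P \<and> norm u \<le> \<epsilon> * \<tau> \<and> \<phi> \<tau> u = 0)" for \<tau>
  have \<xi>: "\<xi> \<tau> \<in> complexification P" "norm (\<xi> \<tau>) \<le> \<epsilon> * \<tau>" "\<phi> \<tau> (\<xi> \<tau>) = 0" if "0 \<le> \<tau>" "\<tau> \<le> \<tau>0" for \<tau>
    using theI'[OF zero[OF that]] by (auto simp: \<xi>_def)
  have graph: "(\<lambda>\<tau>. (\<tau>, \<xi> \<tau>)) ` {0..\<tau>0} = ({0..\<tau>0} \<times> complexification P)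
      \<inter> {q. norm (snd q) \<le> \<epsilon> * fst q} \<inter> {q. \<phi> (fst q) (snd q) = 0}" (is "?L = ?R")
  proof
    show "?L \<subseteq> ?R" using \<xi> by auto
    show "?R \<subseteq> ?L"
    proof
      fix q assume q: "q \<in> ?R"
      then have "\<xi> (fst q) = snd q"
        unfolding \<xi>_def by (intro the1_equality zero) auto
      then have "q = (fst q, \<xi> (fst q))" by simp
      moreover have "fst q \<in> {0..\<tau>0}" using q by auto
      ultimately show "q \<in> ?L" by (rule image_eqI)
    qed
  qed
  have "continuous_on {0..\<tau>0} \<xi>"
  proof (rule continuous_from_closed_graph)
    show "compact (cball 0 (\<epsilon> * \<tau>0) :: ((complex ^ 'n) \<times> (complex ^ 'n)) set)" by simp
    show "\<xi> \<in> {0..\<tau>0} \<rightarrow> cball 0 (\<epsilon> * \<tau>0)"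
      using \<xi>(2) \<epsilon> by (auto intro!: order_trans[OF \<xi>(2)])
    have "continuous_on UNIV (\<lambda>q :: real \<times> (complex ^ 'n) \<times> (complex ^ 'n). imaginary_jets a b (fst q))"
      by (rule continuous_on_compose2[OF continuous_on_imaginary_jets[of UNIV]]) (auto intro: continuous_intros)
    then show "closed ((\<lambda>\<tau>. (\<tau>, \<xi> \<tau>)) ` {0..\<tau>0})"
      unfolding graph \<phi>_def
      by (intro closed_Int closed_Times closed_Collect_le closed_Collect_eq closed_subspace
          subspace_complexification subspace_lagrangian[OF P] continuous_intros) auto
  qed
  moreover have "0 < Im (of_real (z $ j) * exp (fst (imaginary_jets a b \<tau> + \<xi> \<tau>) $ j))" if \<tau>: "0 < \<tau>" "\<tau> \<le> \<tau>0" for \<tau> j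
  proof -
    let ?y = "of_real (z $ j) * exp (fst (imaginary_jets a b \<tau> + \<xi> \<tau>) $ j)"
    have "norm (fst (\<xi> \<tau>) $ j) \<le> \<epsilon> * \<tau>"
      using \<xi>(2)[of \<tau>] \<tau> Finite_Cartesian_Product.norm_nth_le[of "fst (\<xi> \<tau>)" j] norm_fst_le[of "fst (\<xi> \<tau>)" "snd (\<xi> \<tau>)"] by simp
    then have "norm (?y - (of_real (z $ j) + \<i> * of_real (\<tau> * v $ j))) \<le> \<kappa> / (4 * n) * \<tau>"
      using close1[of \<tau> "fst (\<xi> \<tau>) $ j" j] \<tau> by simp
    then have "\<bar>Im (?y - (of_real (z $ j) + \<i> * of_real (\<tau> * v $ j)))\<bar> \<le> \<kappa> / (4 * n) * \<tau>"
      using abs_Im_le_cmod order_trans by blast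
    moreover have "\<kappa> / (4 * n) * \<tau> < v $ j * \<tau>"
    proof (rule mult_strict_right_mono)
      have "\<kappa> / (4 * n) \<le> \<kappa>" using \<kappa> n by (simp add: field_simps)
      then show "\<kappa> / (4 * n) < v $ j" using \<kappa> v0(3)[of j] by linarith
    qed (use \<tau> in simp)
    ultimately show ?thesis by (simp add: algebra_simps abs_le_iff)
  qed
  moreover have "\<xi> 0 = 0" using \<xi>(2)[of 0] \<tau>0 by simp
  ultimately show thesis using that[OF \<tau>0(1), of \<xi>] \<xi> by (simp add: \<phi>_def)
qed

section \<open>Logarithmic edge equations\<close>

definition edge_log_form :: "('n \<times> vertex set) set \<Rightarrow> (real ^ 'n) \<times> (real ^ 'n) \<Rightarrow> real" where
  "edge_log_form E u = (\<Sum>(j, e)\<in>E. fst (log_coeff e) * fst u $ j + snd (log_coeff e) * snd u $ j)"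

definition log_edge_space :: "'n::finite gluing \<Rightarrow> ((real ^ 'n) \<times> (real ^ 'n)) set" where
  "log_edge_space G = {u. \<forall>E\<in>edges G. edge_log_form E u = 0}"

lemma subspace_log_edge_space: "subspace (log_edge_space G)"
proof (rule subspaceI)
  have *: "edge_log_form E 0 = 0" "edge_log_form E (u + w) = edge_log_form E u + edge_log_form E w"
    "edge_log_form E (c *\<^sub>R u) = c * edge_log_form E u" for E and u w :: "(real ^ 'n) \<times> (real ^ 'n)" and c
    by (simp_all add: edge_log_form_def case_prod_beta sum.distrib[symmetric] sum_distrib_left algebra_simps)
  show "0 \<in> log_edge_space G" by (simp add: log_edge_space_def *)
  show "x + y \<in> log_edge_space G" if "x \<in> log_edge_space G" "y \<in> log_edge_space G" for x y
    using that by (simp add: log_edge_space_def *)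
  show "c *\<^sub>R x \<in> log_edge_space G" if "x \<in> log_edge_space G" for x c
    using that by (simp add: log_edge_space_def *)
qed

text \<open>The vector that represents \<open>edge_log_form E\<close> with respect to the symplectic form.\<close>

definition edge_covector :: "('n::finite \<times> vertex set) set \<Rightarrow> (real ^ 'n) \<times> (real ^ 'n)" where
  "edge_covector E = (\<chi> j. \<Sum>e | (j, e) \<in> E. snd (log_coeff e), \<chi> j. - (\<Sum>e | (j, e) \<in> E. fst (log_coeff e)))"

lemma symplectic_form_edge_covector: "symplectic_form (edge_covector E) u = edge_log_form E u"
proof -
  have E: "E = Sigma UNIV (\<lambda>j. {e. (j, e) \<in> E})" by auto
  have "edge_log_form E u = (\<Sum>j\<in>UNIV. \<Sum>e | (j, e) \<in> E. fst (log_coeff e) * fst u $ j + snd (log_coeff e) * snd u $ j)"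
    unfolding edge_log_form_def by (subst E, subst sum.Sigma[symmetric]) auto
  then show ?thesis
    by (simp add: symplectic_form_def edge_covector_def inner_vec_def sum.distrib sum_distrib_right sum_negf)
qed

lemma edge_covectors_isotropic:
  assumes G: "oriented_gluing G" and E: "E \<in> edges G" and E': "E' \<in> edges G"
  shows "symplectic_form (edge_covector E) (edge_covector E') = 0"
proof -
  have "symplectic_form (edge_covector E) (edge_covector E')
    = (\<Sum>j\<in>UNIV. (\<Sum>e | (j, e) \<in> E. fst (log_coeff e)) * (\<Sum>e' | (j, e') \<in> E'. snd (log_coeff e'))
        - (\<Sum>e | (j, e) \<in> E. snd (log_coeff e)) * (\<Sum>e' | (j, e') \<in> E'. fst (log_coeff e')))"
    by (simp add: symplectic_form_def edge_covector_def inner_vec_def sum_subtractf sum_negf)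
  also have "\<dots> = (\<Sum>j\<in>UNIV. \<Sum>e | (j, e) \<in> E. \<Sum>e' | (j, e') \<in> E'. wedge (log_coeff e) (log_coeff e'))"
    by (simp add: wedge_def sum_product sum_subtractf)
  finally show ?thesis using neumann_zagier[OF G E E'] by simp
qed

text \<open>The edge covectors span an isotropic space, and \<open>log_edge_space G\<close> is its symplectic complement, so it
contains every Lagrangian subspace that contains all edge covectors.\<close>

lemma lagrangian_in_log_edge_space:
  assumes "oriented_gluing G"
  obtains P where "lagrangian P" "P \<subseteq> log_edge_space G"
proof -
  obtain P where P: "lagrangian P" "edge_covector ` edges G \<subseteq> P"
    using isotropic_extends_to_lagrangian[of "edge_covector ` edges G"] edge_covectors_isotropic[OF assms]
    by (metis imageE)
  have "P \<subseteq> log_edge_space G"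
  proof
    fix u assume "u \<in> P"
    then have "edge_log_form E u = 0" if "E \<in> edges G" for E
      using lagrangian_isotropic[OF P(1), of "edge_covector E" u] P(2) that
      by (auto simp: symplectic_form_edge_covector)
    then show "u \<in> log_edge_space G" by (simp add: log_edge_space_def)
  qed
  with P show thesis using that by blast
qed

lemma edge_shape_exp:
  fixes z :: real and x p q :: "'a::{real_normed_field, banach}"
  assumes x: "x = of_real z * exp p" and y: "1 - x = of_real (1 - z) * exp q"
  shows "edge_shape x e =
    of_real (edge_shape z e) * exp (of_real (fst (log_coeff e)) * p + of_real (snd (log_coeff e)) * q)"
proof -
  have "1 / (1 - x) = of_real (1 / (1 - z)) * exp (- q)"
    unfolding y by (simp add: exp_minus divide_inverse)
  moreover have "(x - 1) / x = of_real ((z - 1) / z) * exp (q - p)"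
  proof -
    have "x - 1 = of_real (z - 1) * exp q" using y by (simp add: algebra_simps)
    then have "(x - 1) / x = (of_real (z - 1) * exp q) / (of_real z * exp p)" using x by simp
    then show ?thesis by (simp only: exp_diff times_divide_times_eq of_real_divide)
  qed
  ultimately show ?thesis by (simp add: edge_shape_def log_coeff_def x)
qed

lemma smooth_on_derivatives:
  fixes c :: "real \<Rightarrow> 'a::euclidean_space"
  assumes c: "smooth_on S c"
  obtains c' where "\<And>t. t \<in> S \<Longrightarrow> (c has_vector_derivative c' t) (at t)"
    "\<And>t. t \<in> S \<Longrightarrow> c' differentiable (at t)"
proof (rule that[of "\<lambda>t. frechet_derivative c (at t) 1"])
  have Ck: "Ck_on (Suc (Suc 0)) c S" using c unfolding smooth_on_def by blast
  then show "(\<lambda>t. frechet_derivative c (at t) 1) differentiable (at t)" if "t \<in> S" for t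
    using that by simp
  show "(c has_vector_derivative frechet_derivative c (at t) 1) (at t)" if "t \<in> S" for t
  proof -
    have "c differentiable (at t)" using Ck that by simp
    then have "(c has_vector_derivative vector_derivative c (at t)) (at t)"
      by (simp add: vector_derivative_works)
    moreover from this have "frechet_derivative c (at t) = (\<lambda>h. h *\<^sub>R vector_derivative c (at t))"
      unfolding has_vector_derivative_def by (metis frechet_derivative_at)
    ultimately show ?thesis by simp
  qed
qed

lemma has_vector_derivative_component:
  fixes c :: "real \<Rightarrow> real ^ 'n::finite"
  assumes "(c has_vector_derivative d) F"
  shows "((\<lambda>t. c t $ j) has_vector_derivative d $ j) F"
  using bounded_linear.has_vector_derivative[OF bounded_linear_vec_nth assms] .

text \<open>Corresponding coordinates lie in the same component of \<open>\<real> - {0, 1}\<close>, so that the logarithms of the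
quotients are defined.\<close>

definition same_chamber :: "real ^ 'n \<Rightarrow> real ^ 'n \<Rightarrow> bool" where
  "same_chamber x z \<longleftrightarrow> (\<forall>j. 0 < x $ j * z $ j \<and> 0 < (1 - x $ j) * (1 - z $ j))"

lemma eventually_same_chamber:
  fixes c :: "real \<Rightarrow> real ^ 'n::finite"
  assumes c: "(c \<longlongrightarrow> z) F" and z: "\<And>j. z $ j \<noteq> 0" "\<And>j. z $ j \<noteq> 1"
  shows "\<forall>\<^sub>F t in F. same_chamber (c t) z"
proof -
  have "((\<lambda>t. c t $ j * z $ j) \<longlongrightarrow> z $ j * z $ j) F"
    "((\<lambda>t. (1 - c t $ j) * (1 - z $ j)) \<longlongrightarrow> (1 - z $ j) * (1 - z $ j)) F" for j
    by (intro tendsto_intros c)+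
  moreover have "0 < z $ j * z $ j" "0 < (1 - z $ j) * (1 - z $ j)" for j
    using z[of j] by (auto simp: zero_less_mult_iff)
  ultimately have "\<forall>\<^sub>F t in F. 0 < c t $ j * z $ j \<and> 0 < (1 - c t $ j) * (1 - z $ j)" for j
    by (intro eventually_conj order_tendstoD(1))
  then show ?thesis unfolding same_chamber_def by (rule eventually_all_finite)
qed

lemma same_chamber_ratio_pos:
  assumes "same_chamber x z"
  shows "0 < x $ j / z $ j" "0 < (1 - x $ j) / (1 - z $ j)"
proof -
  have "0 < x $ j * z $ j" "0 < (1 - x $ j) * (1 - z $ j)" using assms by (auto simp: same_chamber_def)
  then show "0 < x $ j / z $ j" "0 < (1 - x $ j) / (1 - z $ j)"
    by (simp_all only: zero_less_mult_iff zero_less_divide_iff)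
qed

lemma sum_logs_eq_0:
  fixes G :: "'n::finite gluing" and x z :: "real ^ 'n"
  assumes x: "thurston_real G x" and z: "thurston_real G z" and same: "same_chamber x z" and E: "E \<in> edges G"
  shows "(\<Sum>(j, e)\<in>E. fst (log_coeff e) * ln (x $ j / z $ j) + snd (log_coeff e) * ln ((1 - x $ j) / (1 - z $ j))) = 0"
    (is "(\<Sum>(j, e)\<in>E. ?L j e) = 0")
proof -
  have shape: "edge_shape (x $ j) e = edge_shape (z $ j) e * exp (?L j e)" for j e
  proof -
    note pos = same_chamber_ratio_pos[OF same, of j]
    then have nz: "z $ j \<noteq> 0" "1 - z $ j \<noteq> 0" by auto
    have "x $ j = of_real (z $ j) * exp (ln (x $ j / z $ j))"
      "1 - x $ j = of_real (1 - z $ j) * exp (ln ((1 - x $ j) / (1 - z $ j)))"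
      unfolding exp_ln[OF pos(1)] exp_ln[OF pos(2)] using nz by simp_all
    from edge_shape_exp[OF this, of e] show ?thesis by (simp only: of_real_eq_id id_apply)
  qed
  have "(\<Prod>(j, e)\<in>E. edge_shape (x $ j) e) = (\<Prod>(j, e)\<in>E. edge_shape (z $ j) e) * exp (\<Sum>(j, e)\<in>E. ?L j e)"
    unfolding shape by (simp add: case_prod_beta prod.distrib exp_sum)
  then have "exp (\<Sum>(j, e)\<in>E. ?L j e) = 1"
    using x z E by (simp add: thurston_real_def edge_equations_def)
  then show ?thesis by simp
qed

text \<open>Along the curve the edge forms of the logarithms vanish identically, hence so do those of their first
and second derivatives at \<open>0\<close>, which are \<open>a\<close> and \<open>2 b\<close>.  The quadratic identity comes from the second derivative of
\<open>z e\<^sup>p + (1 - z) e\<^sup>q = 1\<close>.\<close>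

lemma log_jet_of_curve:
  fixes G :: "'n::finite gluing" and z v :: "real ^ 'n"
  assumes z: "thurston_real G z" and tangent: "tangent_vector (real_deformation_variety G) z v"
  obtains a b where "a \<in> log_edge_space G" "b \<in> log_edge_space G"
    "\<And>j. z $ j * fst a $ j = v $ j" "\<And>j. (1 - z $ j) * snd a $ j = - v $ j"
    "\<And>j. z $ j * (fst b $ j + (fst a $ j)\<^sup>2 / 2) + (1 - z $ j) * (snd b $ j + (snd a $ j)\<^sup>2 / 2) = 0"
proof -
  obtain c \<epsilon> where \<epsilon>: "0 < \<epsilon>" and smooth: "smooth_on {- \<epsilon><..<\<epsilon>} c"
    and cD: "c ` {- \<epsilon><..<\<epsilon>} \<subseteq> real_deformation_variety G"
    and c0: "c 0 = z" "(c has_vector_derivative v) (at 0)"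
    using tangent unfolding tangent_vector_def by blast
  have solution: "thurston_real G (c t)" if "t \<in> {- \<epsilon><..<\<epsilon>}" for t
    using cD that unfolding real_deformation_variety_def by blast
  obtain c' where c': "\<And>t. t \<in> {- \<epsilon><..<\<epsilon>} \<Longrightarrow> (c has_vector_derivative c' t) (at t)"
    and c'': "\<And>t. t \<in> {- \<epsilon><..<\<epsilon>} \<Longrightarrow> c' differentiable (at t)"
    using smooth_on_derivatives[OF smooth] by blast
  obtain s where s: "(c' has_vector_derivative s) (at 0)"
    using c''[of 0] \<epsilon> by (auto simp: vector_derivative_works)
  have c'0: "c' 0 = v"
    using c'[of 0] c0(2) \<epsilon> by (auto intro: vector_derivative_unique_at)
  have z01: "z $ j \<noteq> 0" "z $ j \<noteq> 1" for j using z by (auto simp: thurston_real_def)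
  have "isCont c 0" using c0(2) by (rule has_vector_derivative_continuous)
  then have "\<forall>\<^sub>F t in at 0. same_chamber (c t) z"
    using c0(1) by (intro eventually_same_chamber z01) (simp add: isCont_def)
  then obtain \<delta>' where \<delta>': "0 < \<delta>'" "\<And>t. t \<noteq> 0 \<Longrightarrow> \<bar>t\<bar> < \<delta>' \<Longrightarrow> same_chamber (c t) z"
    by (auto simp: eventually_at dist_real_def)
  define \<delta> where "\<delta> = min \<epsilon> \<delta>'"
  have \<delta>: "0 < \<delta>" using \<epsilon> \<delta>' by (simp add: \<delta>_def)
  have "same_chamber z z" using z01 by (auto simp: same_chamber_def zero_less_mult_iff linorder_neq_iff)
  then have same: "same_chamber (c t) z" if "\<bar>t\<bar> < \<delta>" for t
    using that \<delta>' c0(1) by (cases "t = 0") (auto simp: \<delta>_def)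
  have real: "thurston_real G (c t)" if "\<bar>t\<bar> < \<delta>" for t
    using that by (intro solution) (auto simp: \<delta>_def)
  have der: "((\<lambda>t. c t $ j) has_real_derivative c' t $ j) (at t)" if "\<bar>t\<bar> < \<delta>" for t j
    using has_vector_derivative_component[OF c'[of t]] that
    by (auto simp: \<delta>_def abs_less_iff has_real_derivative_iff_has_vector_derivative)
  have der2: "((\<lambda>t. c' t $ j) has_real_derivative s $ j) (at 0)" for j
    using has_vector_derivative_component[OF s] by (simp add: has_real_derivative_iff_has_vector_derivative)
  have vanish: "D = 0" if f: "\<And>t. \<bar>t\<bar> < \<delta> \<Longrightarrow> f t = 0" and D: "(f has_real_derivative D) (at t)" and t: "\<bar>t\<bar> < \<delta>"
    for f :: "real \<Rightarrow> real" and D t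
  proof (rule DERIV_local_const[OF D])
    show "0 < \<delta> - \<bar>t\<bar>" using t by simp
    show "\<forall>y. \<bar>t - y\<bar> < \<delta> - \<bar>t\<bar> \<longrightarrow> f t = f y" using f t by (auto intro!: f)
  qed
  have log1: "((\<lambda>t. ln (c t $ j / z $ j)) has_real_derivative c' t $ j / c t $ j) (at t)"
    and log2: "((\<lambda>t. ln ((1 - c t $ j) / (1 - z $ j))) has_real_derivative - c' t $ j / (1 - c t $ j)) (at t)"
    if t: "\<bar>t\<bar> < \<delta>" for t j
  proof -
    note pos = same_chamber_ratio_pos[OF same[OF t], of j]
    show "((\<lambda>t. ln (c t $ j / z $ j)) has_real_derivative c' t $ j / c t $ j) (at t)"
      by (rule DERIV_cong[OF DERIV_chain2[OF DERIV_ln_divide[OF pos(1)] DERIV_cdivide[OF der[OF t]]]])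
        (use z01[of j] in simp)
    show "((\<lambda>t. ln ((1 - c t $ j) / (1 - z $ j))) has_real_derivative - c' t $ j / (1 - c t $ j)) (at t)"
      by (rule DERIV_cong[OF DERIV_chain2[OF DERIV_ln_divide[OF pos(2)]
            DERIV_cdivide[OF DERIV_diff[OF DERIV_const der[OF t]]]]])
        (use z01[of j] in simp)
  qed
  \<comment> \<open>Here \<open>s\<close> is the acceleration of the curve; these are the second derivatives of the logarithms.\<close>
  have quotient1: "((\<lambda>t. c' t $ j / c t $ j) has_real_derivative s $ j / z $ j - (v $ j / z $ j)\<^sup>2) (at 0)" for j
    by (rule DERIV_cong[OF DERIV_divide[OF der2 der]])
      (use \<delta> c0(1) c'0 z01[of j] in \<open>simp_all add: power2_eq_square diff_divide_distrib\<close>)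
  have quotient2: "((\<lambda>t. - c' t $ j / (1 - c t $ j)) has_real_derivative
      - s $ j / (1 - z $ j) - (v $ j / (1 - z $ j))\<^sup>2) (at 0)" for j
    by (rule DERIV_cong[OF DERIV_divide[OF DERIV_minus[OF der2] DERIV_diff[OF DERIV_const der]]])
      (use \<delta> c0(1) c'0 z01[of j] in \<open>simp_all add: power2_eq_square diff_divide_distrib\<close>)
  define a :: "(real ^ 'n) \<times> (real ^ 'n)" where "a = (\<chi> j. v $ j / z $ j, \<chi> j. - v $ j / (1 - z $ j))"
  define b :: "(real ^ 'n) \<times> (real ^ 'n)" where
    "b = (\<chi> j. (s $ j / z $ j - (v $ j / z $ j)\<^sup>2) / 2, \<chi> j. (- s $ j / (1 - z $ j) - (v $ j / (1 - z $ j))\<^sup>2) / 2)"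
  have forms: "edge_log_form E a = 0 \<and> edge_log_form E b = 0" if E: "E \<in> edges G" for E
  proof -
    define g where "g t = (\<Sum>(j, e)\<in>E. fst (log_coeff e) * ln (c t $ j / z $ j)
        + snd (log_coeff e) * ln ((1 - c t $ j) / (1 - z $ j)))" for t
    define g' where "g' t = (\<Sum>(j, e)\<in>E. fst (log_coeff e) * (c' t $ j / c t $ j)
        + snd (log_coeff e) * (- c' t $ j / (1 - c t $ j)))" for t
    have g: "g t = 0" if "\<bar>t\<bar> < \<delta>" for t
      unfolding g_def by (rule sum_logs_eq_0[OF real[OF that] z same[OF that] E])
    have dg: "(g has_real_derivative g' t) (at t)" if t: "\<bar>t\<bar> < \<delta>" for t
      unfolding g_def g'_def case_prod_beta
    proof (rule DERIV_sum)
      fix je :: "'n \<times> vertex set"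
      show "((\<lambda>t. fst (log_coeff (snd je)) * ln (c t $ fst je / z $ fst je)
          + snd (log_coeff (snd je)) * ln ((1 - c t $ fst je) / (1 - z $ fst je))) has_real_derivative
          fst (log_coeff (snd je)) * (c' t $ fst je / c t $ fst je)
          + snd (log_coeff (snd je)) * (- c' t $ fst je / (1 - c t $ fst je))) (at t)"
        by (intro DERIV_add DERIV_cmult log1 log2 t)
    qed
    have g': "g' t = 0" if t: "\<bar>t\<bar> < \<delta>" for t
      by (rule vanish[of g _ t, OF g dg[OF t] t])
    have "(g' has_real_derivative (\<Sum>(j, e)\<in>E. fst (log_coeff e) * (s $ j / z $ j - (v $ j / z $ j)\<^sup>2)
        + snd (log_coeff e) * (- s $ j / (1 - z $ j) - (v $ j / (1 - z $ j))\<^sup>2))) (at 0)"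
      unfolding g'_def case_prod_beta
    proof (rule DERIV_sum)
      fix je :: "'n \<times> vertex set"
      show "((\<lambda>t. fst (log_coeff (snd je)) * (c' t $ fst je / c t $ fst je)
          + snd (log_coeff (snd je)) * (- c' t $ fst je / (1 - c t $ fst je))) has_real_derivative
          fst (log_coeff (snd je)) * (s $ fst je / z $ fst je - (v $ fst je / z $ fst je)\<^sup>2)
          + snd (log_coeff (snd je)) * (- s $ fst je / (1 - z $ fst je) - (v $ fst je / (1 - z $ fst je))\<^sup>2)) (at 0)"
        by (intro DERIV_add DERIV_cmult quotient1 quotient2)
    qed
    from vanish[of g' _ 0, OF g' this] \<delta>
    have "(\<Sum>(j, e)\<in>E. fst (log_coeff e) * (s $ j / z $ j - (v $ j / z $ j)\<^sup>2)
        + snd (log_coeff e) * (- s $ j / (1 - z $ j) - (v $ j / (1 - z $ j))\<^sup>2)) = 0" by simp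
    also have "(\<Sum>(j, e)\<in>E. fst (log_coeff e) * (s $ j / z $ j - (v $ j / z $ j)\<^sup>2)
        + snd (log_coeff e) * (- s $ j / (1 - z $ j) - (v $ j / (1 - z $ j))\<^sup>2)) = 2 * edge_log_form E b"
      unfolding edge_log_form_def sum_distrib_left b_def by (intro sum.cong refl) (auto simp: field_simps)
    finally have "edge_log_form E b = 0" by simp
    moreover have "edge_log_form E a = g' 0"
      by (simp add: edge_log_form_def g'_def a_def c0 c'0)
    ultimately show ?thesis using g'[of 0] \<delta> by simp
  qed
  show thesis
  proof (rule that[of a b])
    show "a \<in> log_edge_space G" "b \<in> log_edge_space G" using forms by (auto simp: log_edge_space_def)
    show "z $ j * fst a $ j = v $ j" "(1 - z $ j) * snd a $ j = - v $ j" for j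
      using z01[of j] by (simp_all add: a_def)
    show "z $ j * (fst b $ j + (fst a $ j)\<^sup>2 / 2) + (1 - z $ j) * (snd b $ j + (snd a $ j)\<^sup>2 / 2) = 0" for j
    proof -
      have *: "fst b $ j + (fst a $ j)\<^sup>2 / 2 = s $ j / z $ j / 2"
        "snd b $ j + (snd a $ j)\<^sup>2 / 2 = - (s $ j / (1 - z $ j)) / 2"
        by (simp_all add: a_def b_def diff_divide_distrib)
      have cancel: "y * (x / y) = x" if "y \<noteq> 0" for x y :: real using that by simp
      have "z $ j * (s $ j / z $ j) = s $ j" "(1 - z $ j) * (s $ j / (1 - z $ j)) = s $ j"
        by (rule cancel, use z01[of j] in simp)+
      then show ?thesis unfolding * by (simp only: times_divide_eq_right mult_minus_right)
    qed
  qed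
qed

section \<open>Hyperbolic structures\<close>

lemma edge_shape_nonzero: "z \<noteq> 0 \<Longrightarrow> z \<noteq> 1 \<Longrightarrow> edge_shape z e \<noteq> (0::real)"
  by (simp add: edge_shape_def)

lemma Im_edge_shape_pos:
  assumes "0 < Im x"
  shows "0 < Im (edge_shape x e)"
proof -
  have recip: "0 < Im (1 / y)" if "Im y < 0" for y
    using that divide_pos_pos[OF _ add_nonneg_pos[of "(Re y)\<^sup>2" "(Im y)\<^sup>2"], of "- Im y"]
    by (simp add: Im_divide)
  have "0 < Im (1 / (1 - x))" "0 < Im (1 / - x)" using assms recip[of "1 - x"] recip[of "- x"] by auto
  moreover have "(x - 1) / x = 1 + 1 / - x" using assms by (auto simp: field_simps complex_eq_iff)
  ultimately show ?thesis using assms by (simp add: edge_shape_def)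
qed

text \<open>For \<open>r < 0\<close> the candidate \<open>pi + Im w\<close> is in the range of \<open>Arg\<close> only if \<open>Im w \<le> 0\<close>, which follows from the sign of
the imaginary part.\<close>

lemma Arg_of_real_mult_exp:
  assumes "r \<noteq> 0" "\<bar>Im w\<bar> < pi" "0 < Im (of_real r * exp w)"
  shows "Arg (of_real r * exp w) = (if r < 0 then pi else 0) + Im w"
proof (rule Arg_unique[where r = "\<bar>r\<bar> * exp (Re w)"])
  have w: "exp w = of_real (exp (Re w)) * exp (\<i> * of_real (Im w))"
    by (metis exp_add complex_eq exp_of_real)
  show "complex_of_real (\<bar>r\<bar> * exp (Re w)) * exp (\<i> * complex_of_real ((if r < 0 then pi else 0) + Im w)) = of_real r * exp w"
    unfolding w by (simp add: distrib_left exp_add)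
  show "0 < \<bar>r\<bar> * exp (Re w)" using assms by simp
  show "- pi < (if r < 0 then pi else 0) + Im w" using assms(2) by auto
  have "Im w < 0" if "r < 0"
  proof (rule ccontr)
    assume "\<not> Im w < 0"
    then have "0 \<le> sin (Im w)" using assms(2) by (intro sin_ge_zero) auto
    then show False using assms(3) that by (auto simp: Im_exp zero_less_mult_iff mult_less_0_iff)
  qed
  then show "(if r < 0 then pi else 0) + Im w \<le> pi" using assms(2) by auto
qed

text \<open>The linear forms \<open>L\<close> sum to zero over an edge.  Their exponentials therefore multiply to \<open>1\<close>, and the
angles sum to \<open>pi\<close> times the number of negative real shapes, which is \<open>2\<close>.\<close>

lemma hyperbolic_structure_of_logs:
  fixes G :: "'n::finite gluing" and z :: "real ^ 'n" and w
  defines "x \<equiv> \<chi> j. of_real (z $ j) * exp (fst w $ j)"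
  assumes z: "thurston_real G z"
    and w: "w \<in> complexification (log_edge_space G)" "closing_defect z w = 0"
    and small: "\<And>j. \<bar>Im (fst w $ j)\<bar> < pi / 2" "\<And>j. \<bar>Im (snd w $ j)\<bar> < pi / 2"
    and pos: "\<And>j. 0 < Im (x $ j)"
  shows "hyperbolic_structure G x"
proof -
  define L where "L j e = of_real (fst (log_coeff e)) * fst w $ j + of_real (snd (log_coeff e)) * snd w $ j" for j e
  have z01: "z $ j \<noteq> 0" "z $ j \<noteq> 1" for j using z by (auto simp: thurston_real_def)
  have shape: "edge_shape (x $ j) e = of_real (edge_shape (z $ j) e) * exp (L j e)" for j e
    unfolding L_def
  proof (rule edge_shape_exp)
    show "x $ j = of_real (z $ j) * exp (fst w $ j)" by (simp add: x_def)
    have "closing_defect z w $ j = 0" using w(2) by simp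
    then show "1 - x $ j = of_real (1 - z $ j) * exp (snd w $ j)"
      by (simp add: closing_defect_def x_def algebra_simps)
  qed
  have sum0: "(\<Sum>(j, e)\<in>E. L j e) = 0" if E: "E \<in> edges G" for E
  proof -
    have "Re (\<Sum>(j, e)\<in>E. L j e) = edge_log_form E (re_pair w)" "Im (\<Sum>(j, e)\<in>E. L j e) = edge_log_form E (im_pair w)"
      by (simp_all add: L_def edge_log_form_def re_pair_def im_pair_def case_prod_beta)
    then show ?thesis using w(1) E
      by (simp add: complexification_def log_edge_space_def complex_eq_iff)
  qed
  have "(\<Prod>(j, e)\<in>E. edge_shape (x $ j) e) = 1" if E: "E \<in> edges G" for E
  proof -
    have "(\<Prod>(j, e)\<in>E. edge_shape (x $ j) e)
        = of_real (\<Prod>(j, e)\<in>E. edge_shape (z $ j) e) * exp (\<Sum>(j, e)\<in>E. L j e)"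
      by (simp add: shape case_prod_beta prod.distrib exp_sum)
    moreover have "(\<Prod>(j, e)\<in>E. edge_shape (z $ j) e) = 1"
      using z E by (simp add: thurston_real_def edge_equations_def)
    ultimately show ?thesis by (simp only: sum0[OF E] of_real_1 exp_zero mult_1)
  qed
  moreover have "(\<Sum>(j, e)\<in>E. Arg (edge_shape (x $ j) e)) = 2 * pi" if E: "E \<in> edges G" for E
  proof -
    have Arg: "Arg (edge_shape (x $ j) e) = (if edge_shape (z $ j) e < 0 then pi else 0) + Im (L j e)" for j e
      unfolding shape
    proof (rule Arg_of_real_mult_exp)
      show "edge_shape (z $ j) e \<noteq> 0" by (rule edge_shape_nonzero[OF z01])
      show "\<bar>Im (L j e)\<bar> < pi"
        using small[of j] by (auto simp: L_def log_coeff_def)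
      show "0 < Im (of_real (edge_shape (z $ j) e) * exp (L j e))"
        using Im_edge_shape_pos[OF pos, of j e] by (simp only: shape)
    qed
    have "(\<Sum>(j, e)\<in>E. Arg (edge_shape (x $ j) e)) =
        (\<Sum>(j, e)\<in>E. if edge_shape (z $ j) e < 0 then pi else 0) + Im (\<Sum>(j, e)\<in>E. L j e)"
      by (simp add: Arg case_prod_beta sum.distrib)
    also have "(\<Sum>(j, e)\<in>E. if edge_shape (z $ j) e < 0 then pi else 0)
        = pi * real (card {(j, e) \<in> E. edge_shape (z $ j) e < 0})"
    proof -
      have "{(j, e) \<in> E. edge_shape (z $ j) e < 0} = E \<inter> {(j, e). edge_shape (z $ j) e < 0}" by auto
      then show ?thesis by (simp add: case_prod_beta' sum.If_cases mult.commute)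
    qed
    finally show ?thesis using z E sum0[OF E] by (simp add: thurston_real_def)
  qed
  moreover have "x $ j \<noteq> 0 \<and> x $ j \<noteq> 1" for j using pos[of j] by (auto simp: complex_eq_iff)
  ultimately show ?thesis
    using pos by (simp add: hyperbolic_structure_def thurston_complex_def edge_equations_def)
qed

text \<open>Extends a path given for small times only to all positive times.\<close>

lemma collapses_to_min:
  fixes f :: "real \<Rightarrow> 'a::real_normed_algebra_1 ^ 'n::finite"
  assumes f: "continuous_on {0..s} f" and s: "0 < s" and f0: "f 0 = (\<chi> j. of_real (z $ j))"
  shows "collapses_to (\<lambda>t. f (min t s)) z"
proof -
  have cont: "continuous_on {0..} (\<lambda>t. f (min t s))"
    by (rule continuous_on_compose2[OF f]) (use s in \<open>auto intro!: continuous_intros\<close>)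
  then have "((\<lambda>t. f (min t s)) \<longlongrightarrow> f (min 0 s)) (at 0 within {0..})"
    by (auto simp: continuous_on_def)
  then have "((\<lambda>t. f (min t s)) \<longlongrightarrow> (\<chi> j. of_real (z $ j))) (at_right 0)"
    using s f0 by (auto intro: tendsto_within_subset)
  moreover have "continuous_on {0<..} (\<lambda>t. f (min t s))"
    by (rule continuous_on_subset[OF cont]) auto
  ultimately show ?thesis unfolding collapses_to_def by simp
qed

text \<open>The deformation exists for \<open>\<tau> \<le> \<tau>0\<close>; it is cut off at an \<open>s\<close> where the logarithms are below \<open>pi / 2\<close> and kept
constant afterwards.\<close>

lemma hyperbolic_collapse:
  fixes G :: "'n::finite gluing" and z v :: "real ^ 'n"
  assumes G: "oriented_gluing G" and z: "thurston_real G z"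
    and tangent: "tangent_vector (real_deformation_variety G) z v" and v: "\<forall>j. v $ j > 0"
  shows "\<exists>H. (\<forall>t>0. hyperbolic_structure G (H t)) \<and> collapses_to H z"
proof -
  obtain P where P: "lagrangian P" "P \<subseteq> log_edge_space G"
    using lagrangian_in_log_edge_space[OF G] .
  obtain a b where ab: "a \<in> log_edge_space G" "b \<in> log_edge_space G"
    and first: "\<And>j. z $ j * fst a $ j = v $ j" "\<And>j. (1 - z $ j) * snd a $ j = - v $ j"
    and second: "\<And>j. z $ j * (fst b $ j + (fst a $ j)\<^sup>2 / 2) + (1 - z $ j) * (snd b $ j + (snd a $ j)\<^sup>2 / 2) = 0"
    using log_jet_of_curve[OF z tangent] by blast
  obtain \<tau>0 \<xi> where \<tau>0: "0 < \<tau>0" and cont: "continuous_on {0..\<tau>0} \<xi>" and \<xi>0: "\<xi> 0 = 0"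
    and \<xi>P: "\<And>\<tau>. 0 \<le> \<tau> \<Longrightarrow> \<tau> \<le> \<tau>0 \<Longrightarrow> \<xi> \<tau> \<in> complexification P"
    and closing: "\<And>\<tau>. 0 \<le> \<tau> \<Longrightarrow> \<tau> \<le> \<tau>0 \<Longrightarrow> closing_defect z (imaginary_jets a b \<tau> + \<xi> \<tau>) = 0"
    and Im: "\<And>\<tau> j. 0 < \<tau> \<Longrightarrow> \<tau> \<le> \<tau>0 \<Longrightarrow>
      0 < Im (of_real (z $ j) * exp (fst (imaginary_jets a b \<tau> + \<xi> \<tau>) $ j))"
    using lagrangian_deformation[OF P(1) _ first second] v by blast
  define w where "w \<tau> = imaginary_jets a b \<tau> + \<xi> \<tau>" for \<tau>
  define f where "f \<tau> = (\<chi> j. of_real (z $ j) * exp (fst (w \<tau>) $ j))" for \<tau>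
  have w: "continuous_on {0..\<tau>0} w"
    unfolding w_def by (intro continuous_on_add continuous_on_imaginary_jets cont)
  have w0: "w 0 = 0"
    by (simp add: w_def \<xi>0 imaginary_jets_def imaginary_jet_def prod_eq_iff vec_eq_iff)
  have wW: "w \<tau> \<in> complexification (log_edge_space G)" if "0 \<le> \<tau>" "\<tau> \<le> \<tau>0" for \<tau>
  proof -
    have "re_pair (imaginary_jets a b \<tau>) = (- \<tau>\<^sup>2) *\<^sub>R b" "im_pair (imaginary_jets a b \<tau>) = \<tau> *\<^sub>R a"
      by (simp_all add: re_pair_def im_pair_def imaginary_jets_def imaginary_jet_def prod_eq_iff vec_eq_iff
          power2_eq_square)
    then have "imaginary_jets a b \<tau> \<in> complexification (log_edge_space G)"
      using subspace_scale[OF subspace_log_edge_space ab(1), of \<tau>]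
        subspace_scale[OF subspace_log_edge_space ab(2), of "- \<tau>\<^sup>2"]
      by (simp only: complexification_def mem_Collect_eq simp_thms)
    moreover have "\<xi> \<tau> \<in> complexification (log_edge_space G)"
      using \<xi>P[OF that] P(2) by (auto simp: complexification_def)
    ultimately show ?thesis
      unfolding w_def by (intro subspace_add subspace_complexification subspace_log_edge_space)
  qed
  obtain \<delta> where \<delta>: "0 < \<delta>" "\<And>\<tau>. 0 \<le> \<tau> \<Longrightarrow> \<tau> \<le> \<tau>0 \<Longrightarrow> \<tau> < \<delta> \<Longrightarrow> norm (w \<tau>) < pi / 2"
  proof -
    have "\<exists>d>0. \<forall>\<tau>\<in>{0..\<tau>0}. dist \<tau> 0 < d \<longrightarrow> dist (w \<tau>) (w 0) < pi / 2"
      using w[unfolded continuous_on_iff, rule_format, of 0 "pi / 2"] \<tau>0 by simp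
    then show ?thesis using that w0 by auto
  qed
  define s where "s = min \<tau>0 (\<delta> / 2)"
  have s: "0 < s" "s \<le> \<tau>0" "s < \<delta>" using \<tau>0 \<delta> by (auto simp: s_def)
  have "hyperbolic_structure G (f \<tau>)" if \<tau>: "0 < \<tau>" "\<tau> \<le> s" for \<tau>
    unfolding f_def
  proof (rule hyperbolic_structure_of_logs[OF z])
    show "w \<tau> \<in> complexification (log_edge_space G)" "closing_defect z (w \<tau>) = 0"
      using wW closing \<tau> s by (auto simp: w_def)
    have nth: "\<bar>Im (fst u $ j)\<bar> \<le> norm u" "\<bar>Im (snd u $ j)\<bar> \<le> norm u" for u :: "(complex ^ 'n) \<times> (complex ^ 'n)" and j
      using abs_Im_le_cmod[of "fst u $ j"] abs_Im_le_cmod[of "snd u $ j"]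
        Finite_Cartesian_Product.norm_nth_le[of "fst u" j] Finite_Cartesian_Product.norm_nth_le[of "snd u" j]
        norm_fst_le[of "fst u" "snd u"] norm_snd_le[of "snd u" "fst u"] by auto
    show "\<bar>Im (fst (w \<tau>) $ j)\<bar> < pi / 2" "\<bar>Im (snd (w \<tau>) $ j)\<bar> < pi / 2" for j
      using nth[of "w \<tau>" j] \<delta>(2)[of \<tau>] \<tau> s by auto
    show "0 < Im ((\<chi> j. of_real (z $ j) * exp (fst (w \<tau>) $ j)) $ j)" for j
      using Im[of \<tau> j] \<tau> s by (simp add: w_def)
  qed
  then have "\<forall>t>0. hyperbolic_structure G (f (min t s))" using s by simp
  moreover have "collapses_to (\<lambda>t. f (min t s)) z"
  proof (rule collapses_to_min)
    show "continuous_on {0..s} f"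
      unfolding f_def using continuous_on_subset[OF w] s by (intro continuous_intros) auto
    show "f 0 = (\<chi> j. of_real (z $ j))" by (simp add: f_def w0)
  qed (use s in simp)
  ultimately show ?thesis by (intro exI conjI)
qed

section \<open>Anti de Sitter structures\<close>

text \<open>The element \<open>x\<close> with \<open>PRe x + PIm x = a\<close> and \<open>PRe x - PIm x = b\<close>; these two coordinates multiply separately.\<close>

definition pc_of_pair :: "real \<Rightarrow> real \<Rightarrow> pcomplex" where
  "pc_of_pair a b = PComplex ((a + b) / 2) ((a - b) / 2)"

lemma pc_of_pair_simps:
  "pc_of_pair a b * pc_of_pair c d = pc_of_pair (a * c) (b * d)"
  "pc_of_pair a b - pc_of_pair c d = pc_of_pair (a - c) (b - d)"
  "1 = pc_of_pair 1 1"
  "pc_sqnorm (pc_of_pair a b) = a * b"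
  "PRe (pc_of_pair a b) = (a + b) / 2" "PIm (pc_of_pair a b) = (a - b) / 2"
  by (simp_all add: pc_of_pair_def pcomplex_eq_iff pc_sqnorm_def field_simps power2_eq_square)

lemma pc_of_pair_divide:
  assumes "c * d \<noteq> 0"
  shows "pc_of_pair a b / pc_of_pair c d = pc_of_pair (a / c) (b / d)"
  using assms
  by (simp add: divide_pcomplex_def inverse_pcomplex_def pc_of_pair_simps(4))
    (simp add: pc_of_pair_def pcomplex_eq_iff field_simps)

lemma edge_shape_pc_of_pair:
  assumes "a \<noteq> 0" "a \<noteq> 1" "b \<noteq> 0" "b \<noteq> 1"
  shows "edge_shape (pc_of_pair a b) e = pc_of_pair (edge_shape a e) (edge_shape b e)"
  using assms by (simp add: edge_shape_def pc_of_pair_simps(2,3) pc_of_pair_divide)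

text \<open>In the coordinates \<open>pc_of_pair\<close> edge shapes and products are computed separately in each real factor.  Both
factors of a shape have the same sign, so its real part, their mean, is negative exactly when the
shape of \<open>z\<close> is.\<close>

lemma AdS_structure_of_real_pair:
  fixes G :: "'n::finite gluing" and x z :: "real ^ 'n"
  assumes x: "thurston_real G x" and z: "thurston_real G z"
    and sign: "\<And>j. 0 < x $ j * z $ j" "\<And>j. 0 < (1 - x $ j) * (1 - z $ j)"
    and gt: "\<And>j. z $ j < x $ j"
  shows "AdS_structure G (\<chi> j. pc_of_pair (x $ j) (z $ j))"
proof -
  have nz: "x $ j \<noteq> 0" "x $ j \<noteq> 1" "z $ j \<noteq> 0" "z $ j \<noteq> 1" for j
    using x z by (auto simp: thurston_real_def)
  have shape: "edge_shape (pc_of_pair (x $ j) (z $ j)) e = pc_of_pair (edge_shape (x $ j) e) (edge_shape (z $ j) e)" for j e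
    by (rule edge_shape_pc_of_pair[OF nz])
  have neg: "edge_shape (x $ j) e + edge_shape (z $ j) e < 0 \<longleftrightarrow> edge_shape (z $ j) e < 0" for j e
  proof -
    have "(x $ j - 1) * (z $ j - 1) = (1 - x $ j) * (1 - z $ j)" by (simp add: algebra_simps)
    then have "0 < edge_shape (x $ j) e * edge_shape (z $ j) e"
      using sign[of j] unfolding edge_shape_def by (simp add: times_divide_times_eq)
    then show ?thesis by (auto simp: zero_less_mult_iff)
  qed
  have prod: "(\<Prod>(j, e)\<in>E. pc_of_pair (f j e) (g j e)) = pc_of_pair (\<Prod>(j, e)\<in>E. f j e) (\<Prod>(j, e)\<in>E. g j e)"
    if "finite E" for E :: "('n \<times> vertex set) set" and f g
    using that by (induction E rule: finite_induct) (auto simp: pc_of_pair_simps)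
  have "(\<Prod>(j, e)\<in>E. edge_shape (pc_of_pair (x $ j) (z $ j)) e) = 1" if "E \<in> edges G" for E
    using x z that unfolding shape
    by (subst prod) (simp_all add: thurston_real_def edge_equations_def pc_of_pair_simps(3))
  moreover have "card {(j, e) \<in> E. PRe (edge_shape (pc_of_pair (x $ j) (z $ j)) e) < 0} = 2"
    if "E \<in> edges G" for E
    using z that by (simp add: shape pc_of_pair_simps(5) neg thurston_real_def)
  moreover have "0 < pc_sqnorm (pc_of_pair (x $ j) (z $ j))"
    "0 < pc_sqnorm (1 - pc_of_pair (x $ j) (z $ j))" for j
    using sign[of j] by (simp_all only: pc_of_pair_simps(2-4))
  moreover have "0 < PIm (pc_of_pair (x $ j) (z $ j))" for j
    using gt[of j] by (simp add: pc_of_pair_simps(6))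
  ultimately show ?thesis
    by (simp add: AdS_structure_def thurston_pcomplex_def edge_equations_def)
qed

lemma AdS_collapse:
  fixes G :: "'n::finite gluing" and z v :: "real ^ 'n"
  assumes z: "thurston_real G z"
    and tangent: "tangent_vector (real_deformation_variety G) z v" and v: "\<forall>j. v $ j > 0"
  shows "\<exists>A. (\<forall>t>0. AdS_structure G (A t)) \<and> collapses_to A z"
proof -
  obtain c \<epsilon> where \<epsilon>: "0 < \<epsilon>" and smooth: "smooth_on {- \<epsilon><..<\<epsilon>} c"
    and cD: "c ` {- \<epsilon><..<\<epsilon>} \<subseteq> real_deformation_variety G"
    and c0: "c 0 = z" "(c has_vector_derivative v) (at 0)"
    using tangent unfolding tangent_vector_def by blast
  have solution: "thurston_real G (c t)" if "t \<in> {- \<epsilon><..<\<epsilon>}" for t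
    using cD that unfolding real_deformation_variety_def by blast
  have z01: "z $ j \<noteq> 0" "z $ j \<noteq> 1" for j using z by (auto simp: thurston_real_def)
  have "isCont c 0" using c0(2) by (rule has_vector_derivative_continuous)
  then have "(c \<longlongrightarrow> z) (at_right 0)"
    using c0(1) by (auto simp: isCont_def intro: tendsto_within_subset)
  then have "\<forall>\<^sub>F t in at_right 0. same_chamber (c t) z"
    by (intro eventually_same_chamber z01)
  moreover have "\<forall>\<^sub>F t in at_right 0. \<forall>j. z $ j < c t $ j"
  proof (rule eventually_all_finite)
    fix j
    have "((\<lambda>t. c t $ j) has_real_derivative v $ j) (at 0)"
      using has_vector_derivative_component[OF c0(2)] by (simp add: has_real_derivative_iff_has_vector_derivative)
    then obtain d where "0 < d" "\<And>h. 0 < h \<Longrightarrow> h < d \<Longrightarrow> c 0 $ j < c (0 + h) $ j"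
      using DERIV_pos_inc_right[of "\<lambda>t. c t $ j" "v $ j" 0] v by blast
    then show "\<forall>\<^sub>F t in at_right 0. z $ j < c t $ j"
      using c0(1) by (auto simp: eventually_at_right_field)
  qed
  ultimately have "\<forall>\<^sub>F t in at_right 0. same_chamber (c t) z \<and> (\<forall>j. z $ j < c t $ j)"
    by (rule eventually_conj)
  then obtain \<delta> where \<delta>: "0 < \<delta>" "\<And>t. 0 < t \<Longrightarrow> t < \<delta> \<Longrightarrow> same_chamber (c t) z \<and> (\<forall>j. z $ j < c t $ j)"
    by (auto simp: eventually_at_right_field)
  define s where "s = min \<epsilon> \<delta> / 2"
  have s: "0 < s" "s < \<epsilon>" "s < \<delta>" using \<epsilon> \<delta> by (auto simp: s_def)
  define f where "f t = (\<chi> j. pc_of_pair (c t $ j) (z $ j))" for t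
  have "AdS_structure G (f t)" if "0 < t" "t \<le> s" for t
    unfolding f_def
  proof (rule AdS_structure_of_real_pair[OF _ z])
    show "thurston_real G (c t)" using that s by (intro solution) auto
  qed (use \<delta>(2)[of t] that s in \<open>auto simp: same_chamber_def\<close>)
  then have "\<forall>t>0. AdS_structure G (f (min t s))" using s by simp
  moreover have "collapses_to (\<lambda>t. f (min t s)) z"
  proof (rule collapses_to_min)
    have pair: "pc_of_pair x y = x *\<^sub>R PComplex (1 / 2) (1 / 2) + y *\<^sub>R PComplex (1 / 2) (- 1 / 2)" for x y
      by (simp add: pc_of_pair_def pcomplex_eq_iff scaleR_pcomplex_def field_simps)
    have "Ck_on 0 c {- \<epsilon><..<\<epsilon>}" using smooth unfolding smooth_on_def by blast
    then have "continuous_on {0..s} c"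
      using s by (auto elim!: continuous_on_subset)
    then show "continuous_on {0..s} f"
      unfolding f_def pair by (intro continuous_intros)
    show "f 0 = (\<chi> j. of_real (z $ j))"
      by (simp add: f_def c0 pc_of_pair_def of_real_def vec_eq_iff pcomplex_eq_iff scaleR_pcomplex_def)
  qed (use s in simp)
  ultimately show ?thesis by (intro exI conjI)
qed

section \<open>Collapse to the foliation\<close>

theorem proposition12:
  fixes M :: "'m topology" and G :: "'n::finite gluing" and z v :: "real ^ 'n"
  assumes "triangulated_three_manifold M G"
    and "transversely_hyperbolic_foliation G z"
    and "smooth_at (real_deformation_variety G) z"
    and "tangent_vector (real_deformation_variety G) z v"
    and "\<forall>j. v $ j > 0"
  shows "\<exists>(H :: real \<Rightarrow> complex ^ 'n) (A :: real \<Rightarrow> pcomplex ^ 'n).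
    (\<forall>t>0. hyperbolic_structure G (H t)) \<and> (\<forall>t>0. AdS_structure G (A t)) \<and>
    collapses_to H z \<and> collapses_to A z"
proof -
  have G: "oriented_gluing G" using assms(1) unfolding triangulated_three_manifold_def by (elim conjE)
  have z: "thurston_real G z" using assms(2) by (simp add: transversely_hyperbolic_foliation_def)
  obtain H where "\<forall>t>0. hyperbolic_structure G (H t)" "collapses_to H z"
    using hyperbolic_collapse[OF G z assms(4,5)] by auto
  moreover obtain A where "\<forall>t>0. AdS_structure G (A t)" "collapses_to A z"
    using AdS_collapse[OF z assms(4,5)] by auto
  ultimately show ?thesis by (intro exI conjI)
qed

end
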